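(* Consider the $T$-period model with time-invariant like probabilities described in the context, restricted to one-directional interactions (initiating side $I$) and sequential matches. Let $\Pi$ be the set of all adaptive policies satisfying these restrictions and let $\mathrm{OPT}^\Pi$ be the maximum over $\pi\in\Pi$ of the expected total number of matches over the $T$ periods. Then there exists a (possibly randomized) semi-adaptive policy satisfying these restrictions whose expected total number of matches is at least $(1-1/e)\cdot\mathrm{OPT}^\Pi$.
   Context: Model. $I$ and $J$ are finite disjoint sets of users, $T\ge1$ is the number of periods. Each $\ell\in I\cup J$ has a positive integer $K_\ell$ and an initial set of potentials $P^1_\ell$, with $P^1_i\subseteq J$, $P^1_j\subseteq I$ and $\ell'\in P^1_\ell$ iff $\ell\in P^1_{\ell'}$. Whenever $\ell'$ is shown to $\ell$, $\ell$ likes $\ell'$ with probability $\phi_{\ell,\ell'}\in[0,1]$ (independent of period, history and other profiles displayed) and otherwise dislikes it; all like decisions are independent. Initial backlogs $B^1_\ell$ are empty. In each period $t$ a policy selects for each $\ell$ a set $S^t_\ell\subseteq P^t_\ell$ with $|S^t_\ell|\le K_\ell$. After the like/dislike decisions of period $t$ are observed: $P^{t+1}_\ell=P^t_\ell\setminus(S^t_\ell\cup D^t_\ell)$, where $D^t_\ell$ is the set of users who disliked $\ell$ in period $t$; and $B^{t+1}_\ell=(B^t_\ell\cup (P^t_\ell\cap L^t_\ell))\setminus S^t_\ell$, where $L^t_\ell$ is the set of users who liked $\ell$ in period $t$. One-directional interactions with sequential matches: in every period $t$, $S^t_i\subseteq P^t_i$ for $i\in I$ and $S^t_j\subseteq B^t_j$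 for $j\in J$; no pair of users see each other in the same period. A match between $i\in I$ and $j\in J$ occurs in period $t$ iff $j$ is shown $i\in B^t_j$ in period $t$ and likes $i$. A policy is adaptive if it selects the profiles displayed on both sides using information (displays and realized likes/dislikes) from previous periods. A policy is semi-adaptive if the profiles shown to initiate an interaction (to users in $I$) are selected non-adaptively, without using realized likes/dislikes, while the profiles taken from the backlogs (shown to users in $J$) are selected adaptively. *)

theory Defs
  imports "HOL-Probability.Probability"
begin

text \<open>
  A display assigns to each user the set of profiles shown to that user in one period.
  A response \<open>r\<close> records the decisions of one period: \<open>r (l, l')\<close> means that \<open>l\<close> likes \<open>l'\<close>, and it is
  only meaningful when \<open>l'\<close> is shown to \<open>l\<close>.
  Histories list the past periods with the most recent one first, so that the history available
  at the beginning of period \<open>t\<close> (counting from 1) has length \<open>t - 1\<close>.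
\<close>

type_synonym 'u display = "'u \<Rightarrow> 'u set"
type_synonym 'u response = "'u \<times> 'u \<Rightarrow> bool"
type_synonym 'u history = "('u display \<times> 'u response) list"
type_synonym 'u policy = "'u history \<Rightarrow> 'u display"

text \<open>Throughout, \<open>U\<close> stands for the set of all users, i.e. \<open>I \<union> J\<close>.\<close>

definition likers :: "'u set \<Rightarrow> 'u display \<Rightarrow> 'u response \<Rightarrow> 'u \<Rightarrow> 'u set" where
  "likers U S r l = {l' \<in> U. l \<in> S l' \<and> r (l', l)}"

definition dislikers :: "'u set \<Rightarrow> 'u display \<Rightarrow> 'u response \<Rightarrow> 'u \<Rightarrow> 'u set" where
  "dislikers U S r l = {l' \<in> U. l \<in> S l' \<and> \<not> r (l', l)}"

fun potentials :: "'u set \<Rightarrow> ('u \<Rightarrow> 'u set) \<Rightarrow> 'u history \<Rightarrow> 'u \<Rightarrow> 'u set" where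
  "potentials U P1 [] l = P1 l"
| "potentials U P1 ((S, r) # h) l = potentials U P1 h l - (S l \<union> dislikers U S r l)"

fun backlog :: "'u set \<Rightarrow> ('u \<Rightarrow> 'u set) \<Rightarrow> 'u history \<Rightarrow> 'u \<Rightarrow> 'u set" where
  "backlog U P1 [] l = {}"
| "backlog U P1 ((S, r) # h) l =
     (backlog U P1 h l \<union> (potentials U P1 h l \<inter> likers U S r l)) - S l"

definition response_pmf ::
  "'u set \<Rightarrow> ('u \<Rightarrow> 'u \<Rightarrow> real) \<Rightarrow> 'u display \<Rightarrow> 'u response pmf" where
  "response_pmf U \<phi> S =
     Pi_pmf {(l, l'). l \<in> U \<and> l' \<in> S l} False (\<lambda>(l, l'). bernoulli_pmf (\<phi> l l'))"

text \<open>The law of the history after \<open>t\<close> periods when the deterministic policy \<open>\<pi>\<close> is followed.\<close>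

primrec run ::
  "'u set \<Rightarrow> ('u \<Rightarrow> 'u \<Rightarrow> real) \<Rightarrow> 'u policy \<Rightarrow> nat \<Rightarrow> 'u history pmf" where
  "run U \<phi> \<pi> 0 = return_pmf []"
| "run U \<phi> \<pi> (Suc t) =
     bind_pmf (run U \<phi> \<pi> t) (\<lambda>h. map_pmf (\<lambda>r. (\<pi> h, r) # h) (response_pmf U \<phi> (\<pi> h)))"

text \<open>
  Displays allowed after history \<open>h\<close> under one-directional interactions, initiated by \<open>I\<close>, with
  sequential matches.
\<close>

definition feasible ::
  "'u set \<Rightarrow> 'u set \<Rightarrow> ('u \<Rightarrow> nat) \<Rightarrow> ('u \<Rightarrow> 'u set) \<Rightarrow> 'u history \<Rightarrow> 'u display \<Rightarrow> bool" where
  "feasible I J K P1 h S \<longleftrightarrow>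
     (\<forall>l \<in> I \<union> J. S l \<subseteq> potentials (I \<union> J) P1 h l \<and> card (S l) \<le> K l) \<and>
     (\<forall>j \<in> J. S j \<subseteq> backlog (I \<union> J) P1 h j) \<and>
     (\<forall>l \<in> I \<union> J. \<forall>l' \<in> I \<union> J. \<not> (l' \<in> S l \<and> l \<in> S l'))"

definition num_matches ::
  "'u set \<Rightarrow> 'u set \<Rightarrow> ('u \<Rightarrow> 'u set) \<Rightarrow> 'u history \<Rightarrow> 'u display \<Rightarrow> 'u response \<Rightarrow> nat" where
  "num_matches I J P1 h S r =
     card {(i, j). i \<in> I \<and> j \<in> J \<and> i \<in> S j \<and> i \<in> backlog (I \<union> J) P1 h j \<and> r (j, i)}"

fun total_matches :: "'u set \<Rightarrow> 'u set \<Rightarrow> ('u \<Rightarrow> 'u set) \<Rightarrow> 'u history \<Rightarrow> nat" where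
  "total_matches I J P1 [] = 0"
| "total_matches I J P1 ((S, r) # h) = total_matches I J P1 h + num_matches I J P1 h S r"

text \<open>
  Feasibility is demanded only along histories that the policy itself can generate: a display
  schedule fixed in advance need not be feasible after histories in which other profiles were shown.
\<close>

definition adaptive_policy ::
  "'u set \<Rightarrow> 'u set \<Rightarrow> ('u \<Rightarrow> nat) \<Rightarrow> ('u \<Rightarrow> 'u set) \<Rightarrow> ('u \<Rightarrow> 'u \<Rightarrow> real) \<Rightarrow> nat
    \<Rightarrow> 'u policy \<Rightarrow> bool" where
  "adaptive_policy I J K P1 \<phi> T \<pi> \<longleftrightarrow>
     (\<forall>t < T. \<forall>h \<in> set_pmf (run (I \<union> J) \<phi> \<pi> t). feasible I J K P1 h (\<pi> h))"

text \<open>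
  The displays to \<open>I\<close> may depend on the period (the length of the history) only. Past displays to
  \<open>J\<close> are excluded as well, since they carry information about realized likes.
\<close>

definition semi_adaptive_policy ::
  "'u set \<Rightarrow> 'u set \<Rightarrow> ('u \<Rightarrow> nat) \<Rightarrow> ('u \<Rightarrow> 'u set) \<Rightarrow> ('u \<Rightarrow> 'u \<Rightarrow> real) \<Rightarrow> nat
    \<Rightarrow> 'u policy \<Rightarrow> bool" where
  "semi_adaptive_policy I J K P1 \<phi> T \<pi> \<longleftrightarrow>
     adaptive_policy I J K P1 \<phi> T \<pi> \<and>
     (\<forall>h h'. length h = length h' \<longrightarrow> (\<forall>i \<in> I. \<pi> h i = \<pi> h' i))"

text \<open>
  A randomized policy is a distribution over deterministic policies, drawn before the first period
  and independently of all like decisions; deterministic policies are the point masses.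
\<close>

definition adaptive_policies ::
  "'u set \<Rightarrow> 'u set \<Rightarrow> ('u \<Rightarrow> nat) \<Rightarrow> ('u \<Rightarrow> 'u set) \<Rightarrow> ('u \<Rightarrow> 'u \<Rightarrow> real) \<Rightarrow> nat
    \<Rightarrow> 'u policy pmf set" where
  "adaptive_policies I J K P1 \<phi> T = {p. \<forall>\<pi> \<in> set_pmf p. adaptive_policy I J K P1 \<phi> T \<pi>}"

definition semi_adaptive_policies ::
  "'u set \<Rightarrow> 'u set \<Rightarrow> ('u \<Rightarrow> nat) \<Rightarrow> ('u \<Rightarrow> 'u set) \<Rightarrow> ('u \<Rightarrow> 'u \<Rightarrow> real) \<Rightarrow> nat
    \<Rightarrow> 'u policy pmf set" where
  "semi_adaptive_policies I J K P1 \<phi> T =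
     {p. \<forall>\<pi> \<in> set_pmf p. semi_adaptive_policy I J K P1 \<phi> T \<pi>}"

definition expected_matches ::
  "'u set \<Rightarrow> 'u set \<Rightarrow> ('u \<Rightarrow> 'u set) \<Rightarrow> ('u \<Rightarrow> 'u \<Rightarrow> real) \<Rightarrow> nat \<Rightarrow> 'u policy pmf \<Rightarrow> real" where
  "expected_matches I J P1 \<phi> T p =
     measure_pmf.expectation (bind_pmf p (\<lambda>\<pi>. run (I \<union> J) \<phi> \<pi> T))
       (\<lambda>h. real (total_matches I J P1 h))"

definition OPT ::
  "'u set \<Rightarrow> 'u set \<Rightarrow> ('u \<Rightarrow> nat) \<Rightarrow> ('u \<Rightarrow> 'u set) \<Rightarrow> ('u \<Rightarrow> 'u \<Rightarrow> real) \<Rightarrow> nat \<Rightarrow> real" where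
  "OPT I J K P1 \<phi> T = (SUP p \<in> adaptive_policies I J K P1 \<phi> T. expected_matches I J P1 \<phi> T p)"

text \<open>The supremum is taken over a nonempty bounded set, so it is the genuine one.\<close>

lemma adaptive_policies_nonempty: "adaptive_policies I J K P1 \<phi> T \<noteq> {}"
proof -
  have "return_pmf (\<lambda>h l. {}) \<in> adaptive_policies I J K P1 \<phi> T"
    by (auto simp: adaptive_policies_def adaptive_policy_def feasible_def)
  then show ?thesis by blast
qed

lemma total_matches_le:
  assumes "finite I" "finite J"
  shows "total_matches I J P1 h \<le> length h * card (I \<times> J)"
proof (induction h)
  case (Cons x h)
  obtain S r where x: "x = (S, r)" by (cases x)
  have "num_matches I J P1 h S r \<le> card (I \<times> J)"
    unfolding num_matches_def using assms by (intro card_mono) auto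
  with Cons x show ?case by simp
qed simp

lemma length_run: "h \<in> set_pmf (run U \<phi> \<pi> t) \<Longrightarrow> length h = t"
  by (induction t arbitrary: h) auto

lemma expected_matches_le:
  assumes "finite I" "finite J"
  shows "expected_matches I J P1 \<phi> T p \<le> real (T * card (I \<times> J))"
proof -
  let ?q = "bind_pmf p (\<lambda>\<pi>. run (I \<union> J) \<phi> \<pi> T)"
  have le: "real (total_matches I J P1 h) \<le> real (T * card (I \<times> J))" if "h \<in> set_pmf ?q" for h
    using that total_matches_le[OF assms, of P1 h] length_run
    by (metis of_nat_le_iff set_bind_pmf UN_E)
  have "integrable (measure_pmf ?q) (\<lambda>h. real (total_matches I J P1 h))"
    using le by (intro measure_pmf.integrable_const_bound[where B = "real (T * card (I \<times> J))"])
      (auto simp: AE_measure_pmf_iff)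
  then show ?thesis
    unfolding expected_matches_def using le
    by (intro measure_pmf.integral_le_const) (auto simp: AE_measure_pmf_iff)
qed

lemma bdd_above_expected_matches:
  assumes "finite I" "finite J"
  shows "bdd_above (expected_matches I J P1 \<phi> T ` adaptive_policies I J K P1 \<phi> T)"
  using expected_matches_le[OF assms] by (intro bdd_aboveI2) blast

end

theory Submission
  imports Defs
begin

text \<open>
  For a user \<open>j \<in> J\<close> only the times at which the users of \<open>I\<close> enter the backlog matter. Since backlogs
  never expire, showing in each period the \<open>K j\<close> most promising profiles of the backlog is optimal for
  every realization of these times, and the value obtained is a weighted matroid rank, hence a
  monotone submodular function, of the set of pairs (user, arrival time).

  Given an adaptive policy \<open>\<pi>\<close>, draw an independent copy of its run for each \<open>i \<in> I\<close> and let \<open>i\<close> follow the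
  displays that \<open>i\<close> receives in that copy. For fixed \<open>j\<close> this makes the arrival times independent
  across \<open>I\<close> without changing their marginals, and the correlation gap of submodular functions bounds the
  loss by the factor \<open>1 - 1/e\<close>. Some realization of the drawn schedules is at least as good as the
  average, and as there are finitely many schedules, one of them works for the supremum over all \<open>\<pi>\<close>.
\<close>

subsection \<open>The correlation gap\<close>

text \<open>The objective is a sum over \<open>J\<close>, and the expectation of a sum ignores how
  its terms depend on each other. So independence is needed only across \<open>I\<close> for one
  fixed \<open>j\<close>; hence one copy of the run per user of \<open>I\<close>, not one per pair.
  A row of displays taken whole from one run obeys the constraints of its user, and as these bind
  each row separately, rows from different runs still form a schedule. The dependence to be broken
  is carried by the displays: an adaptive policy chooses what to show one user after seeing the
  answers of others. Under a fixed schedule the answers of different users about \<open>j\<close>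
  are independent. The correlation gap is needed for variables with several values, one arrival time
  per user. Its source is a bound on the correlated mean \<open>C\<close> by \<open>f X\<close> plus
  a sum of expected marginal gains. That sum is linear in the joint law and so sees only the
  marginals. Along the ray from no arrivals to the given laws it becomes
  \<open>G' \<ge> C - G\<close>; starting from a nonnegative value, \<open>G\<close> reaches at
  least \<open>(1 - 1/e) * C\<close> at time 1.\<close>

text \<open>An arrival time \<open>T\<close> or later encodes that the user never arrives.\<close>

definition arrivals :: "'i set \<Rightarrow> nat \<Rightarrow> ('i \<Rightarrow> nat) \<Rightarrow> ('i \<times> nat) set" where
  "arrivals I T a = {(i, t). i \<in> I \<and> a i = t \<and> t < T}"

lemma arrivals_subset: "arrivals I T a \<subseteq> I \<times> {..<T}"
  by (auto simp: arrivals_def)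

lemma arrivals_cong: "(\<And>i. i \<in> I \<Longrightarrow> a i = b i) \<Longrightarrow> arrivals I T a = arrivals I T b"
  by (auto simp: arrivals_def)

locale submodular_arrivals =
  fixes I :: "'i set" and T :: nat and f :: "('i \<times> nat) set \<Rightarrow> real"
  assumes finite_I: "finite I"
    and mono: "\<And>X Y. X \<subseteq> Y \<Longrightarrow> Y \<subseteq> I \<times> {..<T} \<Longrightarrow> f X \<le> f Y"
    and submodular: "\<And>X Y e. X \<subseteq> Y \<Longrightarrow> Y \<subseteq> I \<times> {..<T} \<Longrightarrow> e \<in> I \<times> {..<T} \<Longrightarrow>
          f (insert e Y) - f Y \<le> f (insert e X) - f X"
    and empty_nonneg: "0 \<le> f {}"
begin

lemma f_nonneg: "X \<subseteq> I \<times> {..<T} \<Longrightarrow> 0 \<le> f X"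
  using mono[of "{}" X] empty_nonneg by auto

lemma union_le_sum_marginals:
  assumes "X \<subseteq> I \<times> {..<T}" "Y \<subseteq> I \<times> {..<T}"
  shows "f (X \<union> Y) - f X \<le> (\<Sum>e\<in>Y. f (insert e X) - f X)"
proof -
  have "finite Y" using assms(2) finite_I finite_subset by blast
  then show ?thesis using assms(2)
  proof (induction Y)
    case (insert e Y)
    have "f (insert e (X \<union> Y)) - f (X \<union> Y) \<le> f (insert e X) - f X"
      using insert.prems assms(1) by (intro submodular) auto
    with insert show ?case by auto
  qed simp
qed

lemma sum_PiE_split:
  fixes h :: "('i \<Rightarrow> nat) \<Rightarrow> real"
  assumes "i \<in> I"
  shows "(\<Sum>R\<in>PiE I (\<lambda>_. {..T}). h R) =
    (\<Sum>R\<in>PiE (I - {i}) (\<lambda>_. {..T}). \<Sum>t\<le>T. h (R(i := t)))"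
proof -
  have "PiE I (\<lambda>_. {..T}) = PiE (insert i (I - {i})) (\<lambda>_. {..T})"
    using assms by (simp add: insert_absorb)
  also have "\<dots> = (\<lambda>(y, g). g(i := y)) ` ({..T} \<times> PiE (I - {i}) (\<lambda>_. {..T}))"
    by (rule PiE_insert_eq)
  finally have eq: "PiE I (\<lambda>_. {..T}) =
    (\<lambda>(y, g). g(i := y)) ` ({..T} \<times> PiE (I - {i}) (\<lambda>_. {..T}))" .
  have "inj_on (\<lambda>(y, g). g(i := y)) ({..T} \<times> PiE (I - {i}) (\<lambda>_. {..T}))"
    using inj_combinator[of i "I - {i}" "\<lambda>_. {..T}"] by simp
  then have "(\<Sum>R\<in>PiE I (\<lambda>_. {..T}). h R) =
      (\<Sum>(t, R)\<in>{..T} \<times> PiE (I - {i}) (\<lambda>_. {..T}). h (R(i := t)))"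
    unfolding eq by (subst sum.reindex) (auto simp: case_prod_unfold)
  also have "\<dots> = (\<Sum>t\<le>T. \<Sum>R\<in>PiE (I - {i}) (\<lambda>_. {..T}). h (R(i := t)))"
    by (simp add: sum.cartesian_product)
  finally show ?thesis by (subst sum.swap)
qed

lemma arrivals_upd:
  "i \<in> I \<Longrightarrow> t < T \<Longrightarrow> arrivals I T (R(i := t)) = insert (i, t) (arrivals I T (R(i := T)))"
  by (auto simp: arrivals_def split: if_splits)

text \<open>The ray on which the mean is differentiated: at \<open>s = 0\<close> nobody arrives, at
  \<open>s = 1\<close> the masses are those of \<open>q\<close>. The missing mass goes to
  \<open>T\<close>, the code for no arrival, so each coordinate stays a probability law.\<close>

definition scaled :: "('i \<Rightarrow> nat \<Rightarrow> real) \<Rightarrow> real \<Rightarrow> 'i \<Rightarrow> nat \<Rightarrow> real" where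
  "scaled q s i t = (if t < T then s * q i t else 1 - s * (\<Sum>u<T. q i u))"

definition scaled_mean :: "('i \<Rightarrow> nat \<Rightarrow> real) \<Rightarrow> real \<Rightarrow> real" where
  "scaled_mean q s =
     (\<Sum>R\<in>PiE I (\<lambda>_. {..T}). f (arrivals I T R) * (\<Prod>i\<in>I. scaled q s i (R i)))"

text \<open>The expected gain from adding a fresh arrival of \<open>i\<close>, drawn with the masses
  \<open>q i\<close>, to \<open>X\<close>. The set \<open>X\<close> may already hold another arrival
  of \<open>i\<close>, so \<open>f\<close> must be submodular on all sets of pairs and not only on
  those with one time per user.\<close>

definition marginal_gain :: "('i \<Rightarrow> nat \<Rightarrow> real) \<Rightarrow> 'i \<Rightarrow> ('i \<times> nat) set \<Rightarrow> real" where
  "marginal_gain q i X = (\<Sum>t<T. q i t * (f (insert (i, t) X) - f X))"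

lemma sum_atMost_split: "(\<Sum>t\<le>T. h t) = (\<Sum>t<T. h t) + (h T :: real)"
  by (simp add: lessThan_Suc_atMost[symmetric])

lemma sum_scaled: "(\<Sum>t\<le>T. scaled q s i t) = 1"
  unfolding sum_atMost_split by (simp add: scaled_def sum_distrib_left)

lemma DERIV_scaled:
  "((\<lambda>s. scaled q s i t) has_field_derivative (if t < T then q i t else - (\<Sum>u<T. q i u))) (at s)"
proof -
  have 1: "((\<lambda>s. s * c) has_field_derivative c) (at s)" for c :: real
    using DERIV_cmult_right[OF DERIV_ident, of c] by simp
  have 2: "((\<lambda>s. 1 - s * c) has_field_derivative - c) (at s)" for c :: real
    using DERIV_diff[OF DERIV_const 1, of 1 c] by simp
  show ?thesis unfolding scaled_def using 1 2 by auto
qed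

lemma marginal_gain_antimono:
  assumes "\<And>t. t < T \<Longrightarrow> 0 \<le> q i t" "i \<in> I" "X \<subseteq> Y" "Y \<subseteq> I \<times> {..<T}"
  shows "marginal_gain q i Y \<le> marginal_gain q i X"
  unfolding marginal_gain_def using assms
  by (intro sum_mono mult_left_mono submodular) auto

text \<open>With the other coordinates fixed, the derivative in the law of \<open>i\<close> is
  exactly the marginal gain at the set \<open>g\<close> in which \<open>i\<close> does not arrive.
  Letting \<open>i\<close> arrive only enlarges \<open>g\<close>, so by submodularity the marginal
  gains averaged over the arrival of \<open>i\<close> are no larger.\<close>

lemma coordinate_derivative_ge:
  assumes q: "\<And>i t. i \<in> I \<Longrightarrow> t < T \<Longrightarrow> 0 \<le> q i t"
    and p: "\<And>i t. i \<in> I \<Longrightarrow> t \<le> T \<Longrightarrow> 0 \<le> scaled q s i t"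
    and i: "i \<in> I"
  shows "(\<Sum>R\<in>PiE I (\<lambda>_. {..T}). f (arrivals I T R) *
            ((if R i < T then q i (R i) else - (\<Sum>u<T. q i u)) * (\<Prod>k\<in>I - {i}. scaled q s k (R k))))
       \<ge> (\<Sum>R\<in>PiE I (\<lambda>_. {..T}). (\<Prod>k\<in>I. scaled q s k (R k)) * marginal_gain q i (arrivals I T R))"
proof -
  let ?d = "\<lambda>t. if t < T then q i t else - (\<Sum>u<T. q i u)"
  have W: "(\<Prod>k\<in>I - {i}. scaled q s k ((R(i := t)) k)) = (\<Prod>k\<in>I - {i}. scaled q s k (R k))"
    for R t by (intro prod.cong) auto
  have le: "(\<Sum>t\<le>T. (\<Prod>k\<in>I. scaled q s k ((R(i := t)) k)) * marginal_gain q i (arrivals I T (R(i := t))))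
     \<le> (\<Sum>t\<le>T. f (arrivals I T (R(i := t))) * (?d ((R(i := t)) i) *
            (\<Prod>k\<in>I - {i}. scaled q s k ((R(i := t)) k))))"
    if R: "R \<in> PiE (I - {i}) (\<lambda>_. {..T})" for R
  proof -
    define w where "w = (\<Prod>k\<in>I - {i}. scaled q s k (R k))"
    define g where "g = arrivals I T (R(i := T))"
    have w0: "0 \<le> w" unfolding w_def using R p by (intro prod_nonneg) (auto simp: PiE_def Pi_def)
    have sub: "g \<subseteq> arrivals I T (R(i := t))" if "t \<le> T" for t
      unfolding g_def by (auto simp: arrivals_def)
    have "(\<Sum>t\<le>T. (\<Prod>k\<in>I. scaled q s k ((R(i := t)) k)) * marginal_gain q i (arrivals I T (R(i := t))))
      = (\<Sum>t\<le>T. scaled q s i t * w * marginal_gain q i (arrivals I T (R(i := t))))"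
      by (intro sum.cong refl, subst prod.remove[OF finite_I i], subst W) (simp add: w_def)
    also have "\<dots> \<le> (\<Sum>t\<le>T. scaled q s i t * w * marginal_gain q i g)"
      using q i w0 p
      by (intro sum_mono mult_left_mono marginal_gain_antimono mult_nonneg_nonneg sub arrivals_subset)
        auto
    also have "\<dots> = w * marginal_gain q i g"
      using sum_scaled[of q s i] by (simp add: sum_distrib_right[symmetric])
    also have "\<dots> = w * (\<Sum>t\<le>T. f (arrivals I T (R(i := t))) * ?d t)"
      unfolding sum_atMost_split marginal_gain_def
      using i by (simp add: arrivals_upd g_def[symmetric] algebra_simps sum_subtractf
           flip: sum_distrib_left)
    also have "\<dots> = (\<Sum>t\<le>T. f (arrivals I T (R(i := t))) * (?d ((R(i := t)) i) *
            (\<Prod>k\<in>I - {i}. scaled q s k ((R(i := t)) k))))"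
      unfolding W w_def[symmetric] sum_distrib_left by (intro sum.cong) (auto simp: mult_ac)
    finally show ?thesis .
  qed
  show ?thesis unfolding sum_PiE_split[OF i] by (intro sum_mono le)
qed

lemma DERIV_scaled_mean:
  "(scaled_mean q has_field_derivative
     (\<Sum>R\<in>PiE I (\<lambda>_. {..T}). f (arrivals I T R) *
        (\<Sum>i\<in>I. (if R i < T then q i (R i) else - (\<Sum>u<T. q i u)) *
           (\<Prod>k\<in>I - {i}. scaled q s k (R k))))) (at s)"
  unfolding scaled_mean_def[abs_def]
  by (intro DERIV_sum DERIV_cmult has_field_derivative_prod DERIV_scaled)

text \<open>
  Scaling all marginals by \<open>s\<close> gives a mean \<open>G s\<close> with \<open>C - G s \<le> G' s\<close>, so that
  \<open>exp s * (G s - C)\<close> is nondecreasing on \<open>[0, 1]\<close>.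
\<close>

lemma scaled_mean_bound:
  assumes q: "\<And>i t. i \<in> I \<Longrightarrow> t < T \<Longrightarrow> 0 \<le> q i t"
    and q1: "\<And>i. i \<in> I \<Longrightarrow> (\<Sum>t<T. q i t) \<le> 1"
    and C: "\<And>X. X \<subseteq> I \<times> {..<T} \<Longrightarrow> C \<le> f X + (\<Sum>i\<in>I. marginal_gain q i X)"
    and C0: "0 \<le> C"
  shows "(1 - 1 / exp 1) * C \<le> scaled_mean q 1"
proof -
  define G where "G = scaled_mean q"
  have p: "0 \<le> scaled q s i t" if "0 \<le> s" "s \<le> 1" "i \<in> I" for s i t
    using that q[of i t] q1[of i] mult_mono[of s 1 "\<Sum>u<T. q i u" 1]
      sum_nonneg[of "{..<T}" "q i"] q
    by (auto simp: scaled_def)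
  have P1: "(\<Sum>R\<in>PiE I (\<lambda>_. {..T}). \<Prod>i\<in>I. scaled q s i (R i)) = 1" for s
    using sum_scaled by (subst prod_sum_PiE[symmetric]) (auto simp: finite_I)
  have P0: "0 \<le> (\<Prod>i\<in>I. scaled q s i (R i))" if "0 \<le> s" "s \<le> 1" for s R
    using p that by (intro prod_nonneg) auto
  have D: "\<exists>D. (G has_field_derivative D) (at s) \<and> C - G s \<le> D" if s: "0 \<le> s" "s \<le> 1" for s
  proof (intro exI conjI)
    show "(G has_field_derivative (\<Sum>R\<in>PiE I (\<lambda>_. {..T}). f (arrivals I T R) *
        (\<Sum>i\<in>I. (if R i < T then q i (R i) else - (\<Sum>u<T. q i u)) *
           (\<Prod>k\<in>I - {i}. scaled q s k (R k))))) (at s)"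
      unfolding G_def by (rule DERIV_scaled_mean)
    have "C - G s = (\<Sum>R\<in>PiE I (\<lambda>_. {..T}). (\<Prod>i\<in>I. scaled q s i (R i)) * (C - f (arrivals I T R)))"
      unfolding G_def scaled_mean_def right_diff_distrib sum_subtractf
      by (simp add: P1 flip: sum_distrib_right) (simp add: mult.commute)
    also have "\<dots> \<le> (\<Sum>R\<in>PiE I (\<lambda>_. {..T}). (\<Prod>i\<in>I. scaled q s i (R i)) *
        (\<Sum>i\<in>I. marginal_gain q i (arrivals I T R)))"
      using C[OF arrivals_subset] P0[OF s] by (intro sum_mono mult_left_mono) (auto simp: algebra_simps)
    also have "\<dots> = (\<Sum>i\<in>I. \<Sum>R\<in>PiE I (\<lambda>_. {..T}). (\<Prod>i\<in>I. scaled q s i (R i)) *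
        marginal_gain q i (arrivals I T R))"
      unfolding sum_distrib_left by (rule sum.swap)
    also have "\<dots> \<le> (\<Sum>i\<in>I. \<Sum>R\<in>PiE I (\<lambda>_. {..T}). f (arrivals I T R) *
        ((if R i < T then q i (R i) else - (\<Sum>u<T. q i u)) * (\<Prod>k\<in>I - {i}. scaled q s k (R k))))"
      using q p[OF s] by (intro sum_mono coordinate_derivative_ge) auto
    also have "\<dots> = (\<Sum>R\<in>PiE I (\<lambda>_. {..T}). f (arrivals I T R) *
        (\<Sum>i\<in>I. (if R i < T then q i (R i) else - (\<Sum>u<T. q i u)) *
           (\<Prod>k\<in>I - {i}. scaled q s k (R k))))"
      unfolding sum_distrib_left by (rule sum.swap)
    finally show "C - G s \<le> \<dots>" .
  qed
  \<comment> \<open>Only the endpoints are compared. As \<open>G 0\<close> is nonnegative,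
    \<open>exp 1 * (G 1 - C)\<close> is at least \<open>- C\<close>, and dividing by
    \<open>exp 1\<close> produces the constant.\<close>
  have "exp 0 * (G 0 - C) \<le> exp 1 * (G 1 - C)"
  proof (rule DERIV_nonneg_imp_nondecreasing[of 0 1 "\<lambda>s. exp s * (G s - C)"])
    fix s :: real assume s: "0 \<le> s" "s \<le> 1"
    from D[OF s] obtain D where D: "(G has_field_derivative D) (at s)" "C - G s \<le> D" by blast
    have "((\<lambda>s. exp s * (G s - C)) has_real_derivative (exp s * (G s - C) + D * exp s)) (at s)"
      using D(1) by (auto intro!: derivative_eq_intros)
    moreover have "0 \<le> exp s * (D + G s - C)"
      using D(2) by simp
    then have "0 \<le> exp s * (G s - C) + D * exp s"
      by (simp add: algebra_simps)
    ultimately show "\<exists>y. ((\<lambda>s. exp s * (G s - C)) has_real_derivative y) (at s) \<and> 0 \<le> y" by blast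
  qed simp
  moreover have "0 \<le> G 0" unfolding G_def scaled_mean_def
    using f_nonneg[OF arrivals_subset] P0[of 0] by (intro sum_nonneg mult_nonneg_nonneg) auto
  ultimately have "- C \<le> exp 1 * (G 1 - C)" by simp
  then show ?thesis unfolding G_def[symmetric] by (simp add: field_simps)
qed

text \<open>The correlation in \<open>M\<close> is lost at one point: adding \<open>X\<close> to the
  arrivals does not decrease \<open>f\<close>, and the union is bounded by \<open>f X\<close> plus
  single-pair gains. The expectation of these gains involves only the probabilities of single
  arrivals, which \<open>marg\<close> identifies with those of \<open>D\<close>.\<close>

lemma correlation_gap:
  fixes M :: "'w pmf"
  assumes finM: "finite (set_pmf M)"
    and D: "\<And>i. i \<in> I \<Longrightarrow> set_pmf (D i) \<subseteq> {..T}"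
    and marg: "\<And>i t. i \<in> I \<Longrightarrow> t < T \<Longrightarrow>
       measure_pmf.expectation M (\<lambda>x. of_bool (a x i = t)) = pmf (D i) t"
  shows "(1 - 1 / exp 1) * measure_pmf.expectation M (\<lambda>x. f (arrivals I T (a x))) \<le>
    measure_pmf.expectation (Pi_pmf I d D) (\<lambda>R. f (arrivals I T R))"
proof -
  define q where "q i t = pmf (D i) t" for i t
  have one: "(\<Sum>t<T. q i t) + pmf (D i) T = 1" if "i \<in> I" for i
    using sum_pmf_eq_1[of "{..T}" "D i"] D[OF that] by (simp add: sum_atMost_split q_def)
  have scaled_1: "scaled q 1 i t = pmf (D i) t" if "i \<in> I" "t \<le> T" for i t
    using that one[of i] by (auto simp: scaled_def q_def)
  have intg: "integrable (measure_pmf M) h" for h :: "'w \<Rightarrow> real"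
    using finM by (rule integrable_measure_pmf_finite)
  have C: "measure_pmf.expectation M (\<lambda>x. f (arrivals I T (a x))) \<le>
      f X + (\<Sum>i\<in>I. marginal_gain q i X)" if X: "X \<subseteq> I \<times> {..<T}" for X
  proof -
    have "f (arrivals I T (a x)) \<le>
        f X + (\<Sum>i\<in>I. \<Sum>t<T. of_bool (a x i = t) * (f (insert (i, t) X) - f X))" for x
    proof -
      have "f (arrivals I T (a x)) \<le> f (X \<union> arrivals I T (a x))"
        using X arrivals_subset[of I T "a x"] by (intro mono) auto
      also have "\<dots> \<le> f X + (\<Sum>e\<in>arrivals I T (a x). f (insert e X) - f X)"
        using union_le_sum_marginals[OF X arrivals_subset[of I T "a x"]] by linarith
      also have "(\<Sum>e\<in>arrivals I T (a x). f (insert e X) - f X) =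
         (\<Sum>e\<in>I \<times> {..<T}. of_bool (a x (fst e) = snd e) * (f (insert e X) - f X))"
        using finite_I by (intro sum.mono_neutral_cong_left) (auto simp: arrivals_def)
      finally show ?thesis
        unfolding sum.cartesian_product by (simp only: case_prod_unfold fst_conv snd_conv prod.collapse)
    qed
    then have "measure_pmf.expectation M (\<lambda>x. f (arrivals I T (a x))) \<le>
      measure_pmf.expectation M (\<lambda>x.
        f X + (\<Sum>i\<in>I. \<Sum>t<T. of_bool (a x i = t) * (f (insert (i, t) X) - f X)))"
      by (intro integral_mono intg)
    also have "\<dots> = f X + (\<Sum>i\<in>I. marginal_gain q i X)"
      by (simp add: intg marg marginal_gain_def q_def del: sum_of_bool_mult_eq)
    finally show ?thesis .
  qed
  have "(1 - 1 / exp 1) * measure_pmf.expectation M (\<lambda>x. f (arrivals I T (a x))) \<le> scaled_mean q 1"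
  proof (rule scaled_mean_bound)
    show "(\<Sum>t<T. q i t) \<le> 1" if "i \<in> I" for i
      using one[OF that] pmf_nonneg[of "D i" T] by linarith
    show "0 \<le> measure_pmf.expectation M (\<lambda>x. f (arrivals I T (a x)))"
      using f_nonneg[OF arrivals_subset] by (intro integral_nonneg_AE) auto
  qed (use C in \<open>auto simp: q_def\<close>)
  also have "scaled_mean q 1 =
      measure_pmf.expectation (Pi_pmf I undefined D) (\<lambda>R. f (arrivals I T R))"
  proof -
    have fin: "finite (PiE I (\<lambda>_. {..T}))" using finite_I by (intro finite_PiE) auto
    have "set_pmf (Pi_pmf I undefined D) \<subseteq> PiE I (\<lambda>_. {..T})"
    proof -
      have "set_pmf (Pi_pmf I undefined D) = PiE_dflt I undefined (set_pmf \<circ> D)"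
        by (rule set_Pi_pmf[OF finite_I])
      also have "\<dots> \<subseteq> PiE I (\<lambda>_. {..T})"
        using D by (auto simp: PiE_dflt_def PiE_def Pi_def extensional_def)
      finally show ?thesis .
    qed
    then have "measure_pmf.expectation (Pi_pmf I undefined D) (\<lambda>R. f (arrivals I T R)) =
        (\<Sum>R\<in>PiE I (\<lambda>_. {..T}). f (arrivals I T R) * pmf (Pi_pmf I undefined D) R)"
      by (intro integral_measure_pmf_real fin) auto
    also have "\<dots> = scaled_mean q 1" unfolding scaled_mean_def
    proof (intro sum.cong refl)
      fix R assume R: "R \<in> PiE I (\<lambda>_. {..T})"
      have "pmf (Pi_pmf I undefined D) R = (\<Prod>i\<in>I. pmf (D i) (R i))"
        using R by (intro pmf_Pi' finite_I) (auto simp: PiE_def extensional_def)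
      also have "\<dots> = (\<Prod>i\<in>I. scaled q 1 i (R i))"
        using R by (intro prod.cong refl scaled_1[symmetric]) auto
      finally show "f (arrivals I T R) * pmf (Pi_pmf I undefined D) R =
        f (arrivals I T R) * (\<Prod>i\<in>I. scaled q 1 i (R i))" by simp
    qed
    finally show ?thesis ..
  qed
  \<comment> \<open>The sum over \<open>PiE\<close> forces the default \<open>undefined\<close>
    outside \<open>I\<close>. Any other default gives the same mean, because \<open>arrivals\<close>
    reads a function only on \<open>I\<close>.\<close>
  also have "\<dots> = measure_pmf.expectation (Pi_pmf I d D) (\<lambda>R. f (arrivals I T R))"
  proof -
    have "arrivals I T (\<lambda>x. if x \<in> I then R x else undefined) = arrivals I T R" for R
      by (rule arrivals_cong) simp
    then show ?thesis
      unfolding Pi_pmf_default_swap[OF finite_I, of undefined d D, symmetric] by simp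
  qed
  finally show ?thesis .
qed

end

subsection \<open>The value of a backlog\<close>

text \<open>
  The number of items served before period \<open>t\<close> by a server of capacity \<open>k\<close> when \<open>N u\<close> items arrive before
  period \<open>u\<close>; an item can be served from the period after its arrival on.
\<close>

primrec queue :: "nat \<Rightarrow> (nat \<Rightarrow> nat) \<Rightarrow> nat \<Rightarrow> nat" where
  "queue k N 0 = 0"
| "queue k N (Suc t) = min (N t) (queue k N t + k)"

lemma queue_mono: "(\<And>t. N t \<le> N' t) \<Longrightarrow> queue k N t \<le> queue k N' t"
  by (induction t) (auto simp: min_le_iff_disj intro: min.coboundedI1)

lemma queue_cong: "(\<And>u. u < t \<Longrightarrow> N u = N' u) \<Longrightarrow> queue k N t = queue k N' t"
  by (induction t) auto

text \<open>An additional item arriving at \<open>s\<close> helps the busier system \<open>M\<close>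
  no more than \<open>N\<close>. The claim alone is not inductive. The decisive companion is that
  the backlog \<open>N t - queue k N t\<close> never exceeds that of \<open>M\<close>; the others
  say that the item adds at most one service, and none up to time \<open>Suc s\<close>, since an
  arrival at \<open>s\<close> is first counted in \<open>N (Suc s)\<close> and first served after
  that.\<close>

lemma queue_submodular:
  fixes N M :: "nat \<Rightarrow> nat"
  assumes le: "\<And>t. N t \<le> M t"
    and incr: "\<And>t. M t + N (Suc t) \<le> M (Suc t) + N t"
  shows "queue k (\<lambda>t. M t + of_bool (s < t)) t + queue k N t \<le>
         queue k M t + queue k (\<lambda>t. N t + of_bool (s < t)) t"
proof -
  let ?N = "\<lambda>t. N t + of_bool (s < t)" and ?M = "\<lambda>t. M t + of_bool (s < t)"
  have "queue k N t \<le> queue k M t \<and> queue k M t + N t \<le> queue k N t + M t \<and>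
     queue k N t \<le> queue k ?N t \<and> queue k ?N t \<le> queue k N t + 1 \<and>
     queue k M t \<le> queue k ?M t \<and> queue k ?M t \<le> queue k M t + 1 \<and>
     (t \<le> Suc s \<longrightarrow> queue k ?N t = queue k N t \<and> queue k ?M t = queue k M t) \<and>
     queue k ?M t + queue k N t \<le> queue k M t + queue k ?N t"
  proof (induction t)
    case 0
    show ?case using le[of 0] by simp
  next
    case (Suc t)
    show ?case
    proof (cases "s < t")
      case True
      with Suc le[of t] incr[of t] show ?thesis by (simp add: min_def)
    next
      case False
      with Suc le[of t] incr[of t] show ?thesis by (simp add: min_def)
    qed
  qed
  then show ?thesis by blast
qed

text \<open>
  Weights are split into layers because a greedy server, seen from the items of weight at least \<open>\<theta>\<close>,
  is an unweighted queue for every threshold \<open>\<theta>\<close> simultaneously.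
\<close>

definition layer_gap :: "real set \<Rightarrow> real \<Rightarrow> real" where
  "layer_gap \<Theta> = (SOME g. (\<forall>x. 0 \<le> g x) \<and> (\<forall>x\<in>\<Theta>. x = (\<Sum>y\<in>{y \<in> \<Theta>. y \<le> x}. g y)))"

lemma layer_gap_exists:
  assumes "finite \<Theta>" "\<And>x. x \<in> \<Theta> \<Longrightarrow> (0 :: real) \<le> x"
  shows "\<exists>g. (\<forall>x. (0 :: real) \<le> g x) \<and> (\<forall>x\<in>\<Theta>. x = (\<Sum>y\<in>{y \<in> \<Theta>. y \<le> x}. g y))"
  using assms
proof (induction \<Theta> rule: finite_linorder_max_induct)
  case (insert b A)
  then have "\<exists>g. (\<forall>x. (0 :: real) \<le> g x) \<and> (\<forall>x\<in>A. x = (\<Sum>y\<in>{y \<in> A. y \<le> x}. g y))"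
    by simp
  then obtain g where g: "\<And>x. 0 \<le> g x" "\<And>x. x \<in> A \<Longrightarrow> x = (\<Sum>y\<in>{y \<in> A. y \<le> x}. g y)"
    by blast
  have le: "(\<Sum>y\<in>A. g y) \<le> b"
  proof (cases "A = {}")
    case False
    have "{y \<in> A. y \<le> Max A} = A" using insert.hyps by auto
    then have "Max A = (\<Sum>y\<in>A. g y)" using g(2)[of "Max A"] insert.hyps False by auto
    then show ?thesis using insert.hyps False Max_in[of A] by force
  qed (use insert.prems in auto)
  \<comment> \<open>The gaps of \<open>A\<close> add up to its maximum, or to 0 if \<open>A\<close>
    is empty, so the gap of the new maximum \<open>b\<close> is its distance to the previous
    level.\<close>
  let ?g = "g(b := b - (\<Sum>y\<in>A. g y))"
  have b: "b \<notin> A" using insert.hyps by auto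
  have "x = (\<Sum>y\<in>{y \<in> insert b A. y \<le> x}. ?g y)" if "x \<in> insert b A" for x
  proof (cases "x = b")
    case True
    have "{y \<in> insert b A. y \<le> x} = insert b A" using insert.hyps True by auto
    then have "(\<Sum>y\<in>{y \<in> insert b A. y \<le> x}. ?g y) = (\<Sum>y\<in>insert b A. ?g y)" by simp
    also have "\<dots> = ?g b + (\<Sum>y\<in>A. ?g y)" using b insert.hyps by (intro sum.insert) auto
    also have "(\<Sum>y\<in>A. ?g y) = (\<Sum>y\<in>A. g y)" using b by (intro sum.cong) auto
    finally show ?thesis using True by simp
  next
    case False
    then have "{y \<in> insert b A. y \<le> x} = {y \<in> A. y \<le> x}" using insert.hyps that by auto
    moreover have "(\<Sum>y\<in>{y \<in> A. y \<le> x}. ?g y) = (\<Sum>y\<in>{y \<in> A. y \<le> x}. g y)"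
      using b by (intro sum.cong) auto
    ultimately show ?thesis using g(2)[of x] that False by auto
  qed
  moreover have "0 \<le> ?g x" for x using g(1) le by auto
  ultimately show ?case by blast
qed auto

lemma
  assumes "finite \<Theta>" "\<And>x. x \<in> \<Theta> \<Longrightarrow> 0 \<le> x"
  shows layer_gap_nonneg: "0 \<le> layer_gap \<Theta> x"
    and sum_layer_gap: "x \<in> \<Theta> \<Longrightarrow> (\<Sum>y\<in>{y \<in> \<Theta>. y \<le> x}. layer_gap \<Theta> y) = x"
  using someI_ex[OF layer_gap_exists[OF assms]] unfolding layer_gap_def[symmetric] by auto

text \<open>Layer-cake summation: each weight is the sum of the gaps up to it, and the two sums are
  exchanged.\<close>

lemma sum_layers:
  fixes w :: "'i \<Rightarrow> real"
  assumes "finite I" "\<And>i. i \<in> I \<Longrightarrow> 0 \<le> w i" "A \<subseteq> I"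
  shows "(\<Sum>i\<in>A. w i) = (\<Sum>\<theta>\<in>w ` I. layer_gap (w ` I) \<theta> * real (card {i \<in> A. \<theta> \<le> w i}))"
proof -
  have fin: "finite (w ` I)" "finite A" using assms finite_subset by auto
  have "(\<Sum>i\<in>A. w i) = (\<Sum>i\<in>A. \<Sum>\<theta>\<in>{\<theta> \<in> w ` I. \<theta> \<le> w i}. layer_gap (w ` I) \<theta>)"
    using assms fin by (intro sum.cong refl sum_layer_gap[symmetric]) auto
  also have "\<dots> = (\<Sum>i\<in>A. \<Sum>\<theta>\<in>w ` I. layer_gap (w ` I) \<theta> * of_bool (\<theta> \<le> w i))"
    using fin by (intro sum.cong refl sum.mono_neutral_cong_left) auto
  also have "\<dots> = (\<Sum>\<theta>\<in>w ` I. \<Sum>i\<in>A. layer_gap (w ` I) \<theta> * of_bool (\<theta> \<le> w i))"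
    by (rule sum.swap)
  also have "\<dots> = (\<Sum>\<theta>\<in>w ` I. layer_gap (w ` I) \<theta> * real (card {i \<in> A. \<theta> \<le> w i}))"
    using fin by (intro sum.cong refl)
      (simp add: sum_distrib_left[symmetric] of_bool_def sum.If_cases Int_def conj_commute)
  finally show ?thesis .
qed

section \<open>Selecting the heaviest elements of a backlog\<close>

lemma top_subset_exists:
  fixes w :: "'i \<Rightarrow> real"
  assumes "finite B"
  shows "\<exists>A \<subseteq> B. card A = min k (card B) \<and> (\<forall>a\<in>A. \<forall>b\<in>B - A. w b \<le> w a)"
proof (induction k)
  case (Suc k)
  then obtain A where A: "A \<subseteq> B" "card A = min k (card B)" "\<forall>a\<in>A. \<forall>b\<in>B - A. w b \<le> w a" by blast
  have finA: "finite A" using A(1) assms by (rule finite_subset)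
  show ?case
  proof (cases "A = B")
    case True
    with A show ?thesis by (intro exI[of _ B]) auto
  next
    case False
    then have ne: "w ` (B - A) \<noteq> {}" "finite (w ` (B - A))" using A assms by auto
    obtain b where b: "b \<in> B - A" "w b = Max (w ` (B - A))"
      using Max_in[OF ne(2,1)] by auto
    have max: "w c \<le> w b" if "c \<in> B - A" for c using b ne that by auto
    have "card A < card B" using False A assms by (intro psubset_card_mono) auto
    then have "card (insert b A) = min (Suc k) (card B)" using A(2) b finA by simp
    with A b max show ?thesis by (intro exI[of _ "insert b A"]) auto
  qed
qed (auto intro: exI[of _ "{}"])

definition top_subset :: "nat \<Rightarrow> ('i \<Rightarrow> real) \<Rightarrow> 'i set \<Rightarrow> 'i set" where
  "top_subset k w B =
     (SOME A. A \<subseteq> B \<and> card A = min k (card B) \<and> (\<forall>a\<in>A. \<forall>b\<in>B - A. w b \<le> w a))"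

lemma
  assumes "finite B"
  shows top_subset_subset: "top_subset k w B \<subseteq> B"
    and card_top_subset: "card (top_subset k w B) = min k (card B)"
    and top_subset_ge: "a \<in> top_subset k w B \<Longrightarrow> b \<in> B - top_subset k w B \<Longrightarrow> w b \<le> w a"
  using someI_ex[OF top_subset_exists[OF assms, of k w]] unfolding top_subset_def[symmetric] by auto

text \<open>One selection is optimal for all thresholds at once. If some element of weight at least
  \<open>\<theta>\<close> is left out, every selected element reaches \<open>\<theta>\<close> and
  the selection is as large as capacity allows; otherwise it contains the whole level.\<close>

lemma card_top_subset_level:
  assumes "finite B"
  shows "min k (card {b \<in> B. \<theta> \<le> w b}) \<le> card {a \<in> top_subset k w B. \<theta> \<le> w a}"
proof (cases "\<exists>b \<in> B - top_subset k w B. \<theta> \<le> w b")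
  case True
  then obtain b where b: "b \<in> B - top_subset k w B" "\<theta> \<le> w b" by blast
  then have "{a \<in> top_subset k w B. \<theta> \<le> w a} = top_subset k w B"
    using top_subset_ge[OF assms _ b(1)] by force
  moreover have "card {b \<in> B. \<theta> \<le> w b} \<le> card B" using assms by (intro card_mono) auto
  ultimately show ?thesis using card_top_subset[OF assms, of k w] by auto
next
  case False
  then have "{b \<in> B. \<theta> \<le> w b} \<subseteq> {a \<in> top_subset k w B. \<theta> \<le> w a}" by auto
  moreover have "finite (top_subset k w B)" using top_subset_subset[OF assms] assms finite_subset by blast
  ultimately have "card {b \<in> B. \<theta> \<le> w b} \<le> card {a \<in> top_subset k w B. \<theta> \<le> w a}"
    by (intro card_mono) auto
  then show ?thesis by simp
qed

section \<open>The layered queue value of a set of arrivals\<close>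

definition level_count :: "('i \<Rightarrow> real) \<Rightarrow> real \<Rightarrow> ('i \<times> nat) set \<Rightarrow> nat \<Rightarrow> nat" where
  "level_count w \<theta> X t = card {(i, s) \<in> X. s < t \<and> \<theta> \<le> w i}"

text \<open>The layer-cake form of the weight served by a heaviest-first server, written without
  naming the served items. It thus makes sense for sets with several arrivals of one user, each
  counted as a separate item.\<close>

definition queue_value :: "'i set \<Rightarrow> ('i \<Rightarrow> real) \<Rightarrow> nat \<Rightarrow> nat \<Rightarrow> ('i \<times> nat) set \<Rightarrow> real" where
  "queue_value I w k T X =
     (\<Sum>\<theta>\<in>w ` I. layer_gap (w ` I) \<theta> * real (queue k (level_count w \<theta> X) T))"

lemma level_count_insert:
  assumes "finite X" "(i, s) \<notin> X"
  shows "level_count w \<theta> (insert (i, s) X) =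
    (if \<theta> \<le> w i then (\<lambda>t. level_count w \<theta> X t + of_bool (s < t)) else level_count w \<theta> X)"
proof (rule ext)
  fix t
  have fin: "finite {(i, s) \<in> X. s < t \<and> \<theta> \<le> w i}" using assms(1) by (rule rev_finite_subset) auto
  have "{(i', s') \<in> insert (i, s) X. s' < t \<and> \<theta> \<le> w i'} =
    (if s < t \<and> \<theta> \<le> w i then insert (i, s) {(i, s) \<in> X. s < t \<and> \<theta> \<le> w i}
     else {(i, s) \<in> X. s < t \<and> \<theta> \<le> w i})" by auto
  then show "level_count w \<theta> (insert (i, s) X) t =
    (if \<theta> \<le> w i then (\<lambda>t. level_count w \<theta> X t + of_bool (s < t)) else level_count w \<theta> X) t"
    unfolding level_count_def using fin assms(2) by auto
qed

lemma level_count_mono: "X \<subseteq> Y \<Longrightarrow> finite Y \<Longrightarrow> level_count w \<theta> X t \<le> level_count w \<theta> Y t"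
  unfolding level_count_def by (intro card_mono) (auto intro: rev_finite_subset)

text \<open>Arrivals of \<open>Y\<close> outside \<open>X\<close> only accumulate; this is the
  growth hypothesis of \<open>queue_submodular\<close>.\<close>

lemma level_count_diff_incr:
  assumes "X \<subseteq> Y" "finite Y"
  shows "level_count w \<theta> Y t + level_count w \<theta> X (Suc t) \<le>
    level_count w \<theta> Y (Suc t) + level_count w \<theta> X t"
proof -
  have Suc: "level_count w \<theta> Z (Suc t) = level_count w \<theta> Z t + card {(i, s) \<in> Z. s = t \<and> \<theta> \<le> w i}"
    if "Z \<subseteq> Y" for Z
  proof -
    have "finite Z" using that assms finite_subset by auto
    have "{(i, s) \<in> Z. s < Suc t \<and> \<theta> \<le> w i} =
      {(i, s) \<in> Z. s < t \<and> \<theta> \<le> w i} \<union> {(i, s) \<in> Z. s = t \<and> \<theta> \<le> w i}" by auto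
    then show ?thesis unfolding level_count_def using \<open>finite Z\<close>
      by (simp only:, intro card_Un_disjoint) (auto intro: rev_finite_subset)
  qed
  have "card {(i, s) \<in> X. s = t \<and> \<theta> \<le> w i} \<le> card {(i, s) \<in> Y. s = t \<and> \<theta> \<le> w i}"
    using assms by (intro card_mono) (auto intro: rev_finite_subset)
  then show ?thesis using Suc[of X] Suc[of Y] assms by simp
qed

text \<open>The gaps are nonnegative, so it suffices to treat each threshold alone; there a new pair
  either shifts the counts by one after its arrival time or leaves them unchanged.\<close>

lemma queue_value_submodular:
  assumes fin: "finite I" and w: "\<And>i. i \<in> I \<Longrightarrow> 0 \<le> w i"
  shows "submodular_arrivals I T (queue_value I w k T)"
proof
  have g: "0 \<le> layer_gap (w ` I) \<theta>" for \<theta>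
    using fin w by (intro layer_gap_nonneg) auto
  have finite: "finite X" if "X \<subseteq> I \<times> {..<T}" for X
    using that fin finite_subset by blast
  show mono: "queue_value I w k T X \<le> queue_value I w k T Y"
    if "X \<subseteq> Y" "Y \<subseteq> I \<times> {..<T}" for X Y
    unfolding queue_value_def using that g finite
    by (intro sum_mono mult_left_mono of_nat_mono queue_mono level_count_mono) auto
  show "queue_value I w k T (insert e Y) - queue_value I w k T Y \<le>
      queue_value I w k T (insert e X) - queue_value I w k T X"
    if sub: "X \<subseteq> Y" "Y \<subseteq> I \<times> {..<T}" "e \<in> I \<times> {..<T}" for X Y e
  proof (cases "e \<in> Y")
    case True
    then have "insert e Y = Y" by auto
    moreover have "queue_value I w k T X \<le> queue_value I w k T (insert e X)"
      using sub by (intro mono) auto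
    ultimately show ?thesis by simp
  next
    case False
    obtain i s where e: "e = (i, s)" by (cases e)
    have fins: "finite X" "finite Y" using sub finite[of X] finite[of Y] by auto
    have "layer_gap (w ` I) \<theta> * real (queue k (level_count w \<theta> (insert e Y)) T) -
         layer_gap (w ` I) \<theta> * real (queue k (level_count w \<theta> Y) T) \<le>
         layer_gap (w ` I) \<theta> * real (queue k (level_count w \<theta> (insert e X)) T) -
         layer_gap (w ` I) \<theta> * real (queue k (level_count w \<theta> X) T)" for \<theta>
    proof -
      have "queue k (level_count w \<theta> (insert e Y)) T + queue k (level_count w \<theta> X) T \<le>
        queue k (level_count w \<theta> Y) T + queue k (level_count w \<theta> (insert e X)) T"
        using False sub(1) fins unfolding e
        by (subst (1 2) level_count_insert)
          (auto intro!: queue_submodular level_count_mono level_count_diff_incr)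
      then have "real (queue k (level_count w \<theta> (insert e Y)) T) - real (queue k (level_count w \<theta> Y) T) \<le>
        real (queue k (level_count w \<theta> (insert e X)) T) - real (queue k (level_count w \<theta> X) T)"
        by linarith
      from mult_left_mono[OF this g] show ?thesis by (simp add: right_diff_distrib)
    qed
    then show ?thesis unfolding queue_value_def sum_subtractf[symmetric] by (intro sum_mono) auto
  qed
  show "0 \<le> queue_value I w k T {}"
    unfolding queue_value_def using g by (intro sum_nonneg) auto
qed (rule fin)

subsection \<open>Finitely supported distributions\<close>

lemma expectation_bind_finite:
  fixes g :: "'b \<Rightarrow> real"
  assumes "finite (set_pmf p)" "\<And>x. x \<in> set_pmf p \<Longrightarrow> finite (set_pmf (f x))"
  shows "measure_pmf.expectation (bind_pmf p f) g =
    measure_pmf.expectation p (\<lambda>x. measure_pmf.expectation (f x) g)"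
  using assms by (simp add: pmf_expectation_bind[of "set_pmf p"] integral_measure_pmf[of "set_pmf p"])

text \<open>A randomized policy may mix infinitely many deterministic ones, so \<open>p\<close> can
  have infinite support. The nonnegative integral avoids an integrability argument for the
  mixture.\<close>

lemma expectation_bind_le:
  fixes g :: "'b \<Rightarrow> real"
  assumes g: "\<And>y. 0 \<le> g y" and c: "0 \<le> c"
    and f: "\<And>x. x \<in> set_pmf p \<Longrightarrow> integrable (measure_pmf (f x)) g"
      "\<And>x. x \<in> set_pmf p \<Longrightarrow> measure_pmf.expectation (f x) g \<le> c"
  shows "measure_pmf.expectation (bind_pmf p f) g \<le> c"
proof -
  have "(\<integral>\<^sup>+ y. ennreal (g y) \<partial>measure_pmf (bind_pmf p f)) =
      (\<integral>\<^sup>+ x. \<integral>\<^sup>+ y. ennreal (g y) \<partial>measure_pmf (f x) \<partial>measure_pmf p)" by simp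
  also have "\<dots> \<le> (\<integral>\<^sup>+ x. ennreal c \<partial>measure_pmf p)"
  proof (rule nn_integral_mono_AE, unfold AE_measure_pmf_iff, rule ballI)
    fix x assume x: "x \<in> set_pmf p"
    have "(\<integral>\<^sup>+ y. ennreal (g y) \<partial>measure_pmf (f x)) = ennreal (measure_pmf.expectation (f x) g)"
      by (rule nn_integral_eq_integral[OF f(1)[OF x]]) (simp add: g)
    also have "\<dots> \<le> ennreal c" by (rule ennreal_leI[OF f(2)[OF x]])
    finally show "(\<integral>\<^sup>+ y. ennreal (g y) \<partial>measure_pmf (f x)) \<le> ennreal c" .
  qed
  also have "\<dots> = ennreal c" by simp
  finally have "(\<integral>\<^sup>+ y. ennreal (g y) \<partial>measure_pmf (bind_pmf p f)) \<le> ennreal c" .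
  then show ?thesis
    by (subst integral_eq_nn_integral) (simp_all add: g c enn2real_leI)
qed

lemma expectation_le_some:
  fixes g :: "'a \<Rightarrow> real"
  assumes "finite (set_pmf p)"
  shows "\<exists>x\<in>set_pmf p. measure_pmf.expectation p g \<le> g x"
proof -
  have ne: "finite (g ` set_pmf p)" "g ` set_pmf p \<noteq> {}" using assms set_pmf_not_empty[of p] by auto
  have "measure_pmf.expectation p g \<le> Max (g ` set_pmf p)"
    using assms ne by (intro measure_pmf.integral_le_const integrable_measure_pmf_finite)
      (auto simp: AE_measure_pmf_iff)
  moreover have "Max (g ` set_pmf p) \<in> g ` set_pmf p" by (rule Max_in[OF ne])
  then obtain x where x: "x \<in> set_pmf p" "Max (g ` set_pmf p) = g x" by (rule imageE)
  ultimately have "measure_pmf.expectation p g \<le> g x" by (simp only:)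
  with x(1) show ?thesis by (rule bexI[rotated])
qed

lemma finite_set_Pi_pmf:
  assumes "finite A" "\<And>x. x \<in> A \<Longrightarrow> finite (set_pmf (p x))"
  shows "finite (set_pmf (Pi_pmf A d p))"
  using assms by (auto simp: set_Pi_pmf intro!: finite_PiE_dflt)

lemma Pi_pmf_reindex:
  assumes "finite A" "inj_on h A"
  shows "map_pmf (\<lambda>g x. if x \<in> A then g (h x) else d) (Pi_pmf (h ` A) d p) =
    Pi_pmf A d (\<lambda>x. p (h x))"
  using assms
proof (induction A rule: finite_induct)
  case (insert x A)
  have "h z \<noteq> h x" if "z \<in> A" for z
    using inj_onD[OF insert.prems, of z x] that insert.hyps by blast
  then have eq: "(\<lambda>x'. if x' \<in> insert x A then (f(h x := y)) (h x') else d) =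
      (\<lambda>x'. if x' \<in> A then f (h x') else d)(x := y)" for f y
    by (auto simp: fun_eq_iff)
  have "map_pmf (\<lambda>g x'. if x' \<in> insert x A then g (h x') else d) (Pi_pmf (h ` insert x A) d p) =
     do {y \<leftarrow> p (h x); f \<leftarrow> Pi_pmf (h ` A) d p;
         return_pmf (\<lambda>x'. if x' \<in> insert x A then (f(h x := y)) (h x') else d)}"
    using insert.hyps insert.prems
    by (simp only: image_insert, subst Pi_pmf_insert') (auto simp: map_pmf_def bind_assoc_pmf bind_return_pmf)
  also have "\<dots> = do {y \<leftarrow> p (h x); f \<leftarrow> map_pmf (\<lambda>g x. if x \<in> A then g (h x) else d) (Pi_pmf (h ` A) d p);
         return_pmf (f(x := y))}"
    unfolding eq by (simp add: map_pmf_def bind_assoc_pmf bind_return_pmf)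
  also have "\<dots> = Pi_pmf (insert x A) d (\<lambda>x. p (h x))"
    using insert by (subst Pi_pmf_insert') auto
  finally show ?case .
qed (simp add: map_pmf_const)

lemma Pi_pmf_map_pmf:
  assumes "finite A"
  shows "Pi_pmf A d (\<lambda>x. map_pmf (F x) (p x)) =
    map_pmf (\<lambda>f x. if x \<in> A then F x (f x) else d) (Pi_pmf A d' p)"
  using Pi_pmf_bind[OF assms, of d p "\<lambda>x y. return_pmf (F x y)" d'] assms
  by (simp add: map_pmf_def)

text \<open>The answers about \<open>j\<close> form one column of the product over displayed pairs,
  with at most one entry per user of \<open>I\<close>, and are therefore independent. Users who are
  not shown \<open>j\<close> receive the constant answer \<open>False\<close>; \<open>F i\<close>
  later turns an answer into an updated arrival time.\<close>

lemma response_pmf_column: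
  assumes "finite U" "\<And>l. l \<in> U \<Longrightarrow> finite (S l)" "I \<subseteq> U"
  shows "map_pmf (\<lambda>r i. if i \<in> I then F i (j \<in> S i \<and> r (i, j)) else d) (response_pmf U \<phi> S) =
    Pi_pmf I d (\<lambda>i. map_pmf (F i) (if j \<in> S i then bernoulli_pmf (\<phi> i j) else return_pmf False))"
proof -
  let ?D = "{(l, l'). l \<in> U \<and> l' \<in> S l}" and ?A = "{i \<in> I. j \<in> S i}"
  let ?p = "\<lambda>(l, l'). bernoulli_pmf (\<phi> l l')"
  have finI: "finite I" using assms finite_subset by blast
  have "?D = Sigma U S" by auto
  then have finD: "finite ?D" using assms by auto
  have sub: "(\<lambda>i. (i, j)) ` ?A \<subseteq> ?D" using assms by auto
  have "Pi_pmf I False (\<lambda>i. if j \<in> S i then bernoulli_pmf (\<phi> i j) else return_pmf False) =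
     Pi_pmf ?A False (\<lambda>i. bernoulli_pmf (\<phi> i j))"
    using Pi_pmf_if_set[OF finI, of False "\<lambda>i. j \<in> S i" "\<lambda>i. bernoulli_pmf (\<phi> i j)"] by simp
  also have "\<dots> = map_pmf (\<lambda>g i. if i \<in> ?A then g (i, j) else False) (Pi_pmf ((\<lambda>i. (i, j)) ` ?A) False ?p)"
    using Pi_pmf_reindex[of ?A "\<lambda>i. (i, j)" False ?p] finI by (auto simp: inj_on_def)
  also have "\<dots> = map_pmf (\<lambda>r i. i \<in> ?A \<and> r (i, j)) (response_pmf U \<phi> S)"
    unfolding response_pmf_def Pi_pmf_subset[OF finD sub] map_pmf_comp
    by (intro map_pmf_cong refl) auto
  finally have col: "Pi_pmf I False (\<lambda>i. if j \<in> S i then bernoulli_pmf (\<phi> i j) else return_pmf False) =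
    map_pmf (\<lambda>r i. i \<in> ?A \<and> r (i, j)) (response_pmf U \<phi> S)" .
  show ?thesis
    unfolding Pi_pmf_map_pmf[OF finI, of d _ _ False] col map_pmf_comp
    by (intro map_pmf_cong refl) (auto simp: fun_eq_iff)
qed

lemma response_pmf_component:
  assumes "finite U" "\<And>l. l \<in> U \<Longrightarrow> finite (S l)" "l \<in> U" "l' \<in> S l"
  shows "map_pmf (\<lambda>r. r (l, l')) (response_pmf U \<phi> S) = bernoulli_pmf (\<phi> l l')"
proof -
  have "{(l, l'). l \<in> U \<and> l' \<in> S l} = Sigma U S" by auto
  then have "finite {(l, l'). l \<in> U \<and> l' \<in> S l}" using assms by auto
  then show ?thesis unfolding response_pmf_def using assms by (subst Pi_pmf_component) auto
qed

lemma finite_set_response_pmf: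
  assumes "finite U" "\<And>l. l \<in> U \<Longrightarrow> finite (S l)"
  shows "finite (set_pmf (response_pmf U \<phi> S))"
proof -
  have "{(l, l'). l \<in> U \<and> l' \<in> S l} = Sigma U S" by auto
  then have "finite {(l, l'). l \<in> U \<and> l' \<in> S l}" using assms by auto
  then show ?thesis unfolding response_pmf_def by (intro finite_set_Pi_pmf) auto
qed

subsection \<open>Histories\<close>

lemma potentials_subset: "potentials U P1 h l \<subseteq> P1 l"
  by (induction U P1 h l rule: potentials.induct) auto

lemma backlog_subset: "backlog U P1 h l \<subseteq> P1 l"
  by (induction U P1 h l rule: backlog.induct) (use potentials_subset in fastforce)+

text \<open>Periods are counted from 0: the newest entry on top of \<open>h\<close> belongs to
  period \<open>length h\<close>. The value \<open>T\<close> stands for a like that has not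
  occurred.\<close>

fun arrival :: "nat \<Rightarrow> 'u history \<Rightarrow> 'u \<Rightarrow> 'u \<Rightarrow> nat" where
  "arrival T [] j i = T"
| "arrival T ((S, r) # h) j i = (if j \<in> S i \<and> r (i, j) then length h else arrival T h j i)"

fun served :: "'u history \<Rightarrow> 'u \<Rightarrow> 'u set" where
  "served [] j = {}"
| "served ((S, r) # h) j = served h j \<union> S j"

fun displayed :: "'u history \<Rightarrow> nat \<Rightarrow> 'u display" where
  "displayed [] t i = {}"
| "displayed ((S, r) # h) t i = (if t = length h then S i else displayed h t i)"

text \<open>The law that the arrival time would have if the displays \<open>c\<close> were fixed
  beforehand and every display of \<open>j\<close> were answered by a fresh coin of bias
  \<open>p\<close>.\<close>

primrec arrival_law :: "nat \<Rightarrow> real \<Rightarrow> 'u \<Rightarrow> (nat \<Rightarrow> 'u set) \<Rightarrow> nat \<Rightarrow> nat pmf" where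
  "arrival_law T p j c 0 = return_pmf T"
| "arrival_law T p j c (Suc t) = bind_pmf (arrival_law T p j c t)
     (\<lambda>x. map_pmf (\<lambda>b. if b then t else x) (if j \<in> c t then bernoulli_pmf p else return_pmf False))"

lemma arrival_law_cong:
  "(\<And>s. s < t \<Longrightarrow> c s = c' s) \<Longrightarrow> arrival_law T p j c t = arrival_law T p j c' t"
  by (induction t) auto

lemma arrival_law_undisplayed:
  "(\<And>s. s < t \<Longrightarrow> j \<notin> c s) \<Longrightarrow> arrival_law T p j c t = return_pmf T"
  by (induction t) (auto simp: bind_return_pmf)

lemma set_arrival_law: "t \<le> T \<Longrightarrow> set_pmf (arrival_law T p j c t) \<subseteq> {..T}"
  by (induction t) (auto split: if_splits)

lemma arrival_fresh: "j \<in> potentials U P1 h i \<Longrightarrow> arrival T h j i = T"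
  by (induction h) auto

lemma potentials_served: "i \<in> potentials U P1 h j \<Longrightarrow> i \<notin> served h j"
  by (induction h) auto

lemma potentials_displayed: "j \<in> potentials U P1 h i \<Longrightarrow> j \<notin> displayed h t i"
  by (induction h) (auto split: if_splits)

lemma backlog_arrival:
  "i \<in> backlog U P1 h j \<Longrightarrow> arrival T h j i < length h \<and> i \<notin> served h j"
  by (induction h) (auto simp: likers_def less_SucI dest: potentials_served)

subsection \<open>The upper bound for adaptive policies\<close>

locale two_sided_market =
  fixes I J :: "'u set" and K :: "'u \<Rightarrow> nat" and P1 :: "'u \<Rightarrow> 'u set"
    and \<phi> :: "'u \<Rightarrow> 'u \<Rightarrow> real" and T :: nat
  assumes finite_I: "finite I" and finite_J: "finite J" and disjoint: "I \<inter> J = {}"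
    and P1_I: "\<And>i. i \<in> I \<Longrightarrow> P1 i \<subseteq> J"
    and P1_J: "\<And>j. j \<in> J \<Longrightarrow> P1 j \<subseteq> I"
    and P1_sym: "\<And>l l'. l \<in> I \<union> J \<Longrightarrow> l' \<in> I \<union> J \<Longrightarrow> l' \<in> P1 l \<longleftrightarrow> l \<in> P1 l'"
    and \<phi>_bounds: "\<And>l l'. l \<in> I \<union> J \<Longrightarrow> l' \<in> I \<union> J \<Longrightarrow> 0 \<le> \<phi> l l' \<and> \<phi> l l' \<le> 1"
begin

abbreviation U :: "'u set" where "U \<equiv> I \<union> J"

text \<open>Feasibility of all past displays without reference to a policy, so that pathwise facts
  follow by induction on the history.\<close>

fun admissible :: "'u history \<Rightarrow> bool" where
  "admissible [] = True"
| "admissible ((S, r) # h) \<longleftrightarrow> admissible h \<and> feasible I J K P1 h S"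

lemma finite_U: "finite U"
  using finite_I finite_J by simp

lemma finite_P1: "l \<in> U \<Longrightarrow> finite (P1 l)"
  by (elim UnE) (rule finite_subset[OF P1_I finite_J] finite_subset[OF P1_J finite_I], assumption)+

lemma feasible_potentials: "feasible I J K P1 h S \<Longrightarrow> l \<in> U \<Longrightarrow> S l \<subseteq> potentials U P1 h l"
  by (auto simp: feasible_def)

lemma feasible_P1: "feasible I J K P1 h S \<Longrightarrow> l \<in> U \<Longrightarrow> S l \<subseteq> P1 l"
  by (rule order_trans[OF feasible_potentials potentials_subset])

lemma feasible_finite: "feasible I J K P1 h S \<Longrightarrow> l \<in> U \<Longrightarrow> finite (S l)"
  by (rule finite_subset[OF feasible_P1 finite_P1])

lemma feasible_backlog: "feasible I J K P1 h S \<Longrightarrow> j \<in> J \<Longrightarrow> S j \<subseteq> backlog U P1 h j"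
  by (auto simp: feasible_def)

lemma finite_response: "feasible I J K P1 h S \<Longrightarrow> finite (set_pmf (response_pmf U \<phi> S))"
  by (rule finite_set_response_pmf[OF finite_U feasible_finite])

lemma adaptive_feasible:
  "adaptive_policy I J K P1 \<phi> T \<pi> \<Longrightarrow> t < T \<Longrightarrow> h \<in> set_pmf (run U \<phi> \<pi> t) \<Longrightarrow>
    feasible I J K P1 h (\<pi> h)"
  by (simp add: adaptive_policy_def)

lemma adaptive_run:
  assumes "adaptive_policy I J K P1 \<phi> T \<pi>" "t \<le> T" "h \<in> set_pmf (run U \<phi> \<pi> t)"
  shows "admissible h"
  using assms(2,3)
proof (induction t arbitrary: h)
  case (Suc t)
  then obtain h' r where h: "h = (\<pi> h', r) # h'" "h' \<in> set_pmf (run U \<phi> \<pi> t)"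
    by auto
  with Suc show ?case using adaptive_feasible[OF assms(1), of t h'] by simp
qed simp

lemma finite_set_run:
  assumes "adaptive_policy I J K P1 \<phi> T \<pi>" "t \<le> T"
  shows "finite (set_pmf (run U \<phi> \<pi> t))"
  using assms(2)
proof (induction t)
  case (Suc t)
  have "finite (set_pmf (response_pmf U \<phi> (\<pi> h)))" if "h \<in> set_pmf (run U \<phi> \<pi> t)" for h
    using finite_response[OF adaptive_feasible[OF assms(1) _ that]] Suc.prems by simp
  with Suc show ?case by auto
qed simp

lemma expectation_run_Suc:
  fixes g :: "'u history \<Rightarrow> real"
  assumes "adaptive_policy I J K P1 \<phi> T \<pi>" "t < T"
  shows "measure_pmf.expectation (run U \<phi> \<pi> (Suc t)) g =
    measure_pmf.expectation (run U \<phi> \<pi> t)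
      (\<lambda>h. measure_pmf.expectation (response_pmf U \<phi> (\<pi> h)) (\<lambda>r. g ((\<pi> h, r) # h)))"
proof -
  have "finite (set_pmf (response_pmf U \<phi> (\<pi> h)))" if "h \<in> set_pmf (run U \<phi> \<pi> t)" for h
    using finite_response[OF adaptive_feasible[OF assms that]] .
  then show ?thesis
    using finite_set_run[OF assms(1), of t] assms(2)
    by (simp add: expectation_bind_finite)
qed

lemma expectation_run_cong:
  fixes f g :: "'u history \<Rightarrow> real"
  assumes "adaptive_policy I J K P1 \<phi> T \<pi>" "t \<le> T"
    and "\<And>h. admissible h \<Longrightarrow> length h = t \<Longrightarrow> h \<in> set_pmf (run U \<phi> \<pi> t) \<Longrightarrow> f h = g h"
  shows "measure_pmf.expectation (run U \<phi> \<pi> t) f = measure_pmf.expectation (run U \<phi> \<pi> t) g"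
  using assms(3) adaptive_run[OF assms(1,2)] length_run[of _ U \<phi> \<pi> t]
  by (intro integral_cong_AE) (simp_all add: AE_measure_pmf_iff)

lemma expectation_run_mono:
  fixes f g :: "'u history \<Rightarrow> real"
  assumes "adaptive_policy I J K P1 \<phi> T \<pi>" "t \<le> T"
    and "\<And>h. admissible h \<Longrightarrow> length h = t \<Longrightarrow> h \<in> set_pmf (run U \<phi> \<pi> t) \<Longrightarrow> f h \<le> g h"
  shows "measure_pmf.expectation (run U \<phi> \<pi> t) f \<le> measure_pmf.expectation (run U \<phi> \<pi> t) g"
  using assms(3) adaptive_run[OF assms(1,2)] length_run[of _ U \<phi> \<pi> t] finite_set_run[OF assms(1,2)]
  by (intro integral_mono_AE integrable_measure_pmf_finite) (simp_all add: AE_measure_pmf_iff)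

section \<open>Expected matches as expected served weight\<close>

definition served_value :: "'u history \<Rightarrow> real" where
  "served_value h = (\<Sum>j\<in>J. \<Sum>i\<in>served h j. \<phi> j i)"

lemma served_subset: "admissible h \<Longrightarrow> j \<in> J \<Longrightarrow> served h j \<subseteq> I"
proof (induction h rule: admissible.induct)
  case (2 S r h)
  then have "S j \<subseteq> I" using feasible_P1[of h S j] P1_J[of j] by auto
  with 2 show ?case by auto
qed simp

lemma finite_served: "admissible h \<Longrightarrow> j \<in> J \<Longrightarrow> finite (served h j)"
  using finite_subset[OF served_subset finite_I] .

lemma served_value_Cons:
  assumes "admissible ((S, r) # h)"
  shows "served_value ((S, r) # h) = served_value h + (\<Sum>j\<in>J. \<Sum>i\<in>S j. \<phi> j i)"
proof -
  have "(\<Sum>i\<in>served h j \<union> S j. \<phi> j i) = (\<Sum>i\<in>served h j. \<phi> j i) + (\<Sum>i\<in>S j. \<phi> j i)"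
    if "j \<in> J" for j
  proof (rule sum.union_disjoint)
    show "finite (served h j)" using finite_served[of h j] assms that by simp
    show "finite (S j)" using assms that feasible_finite[of h S j] by auto
    show "served h j \<inter> S j = {}"
      using assms that feasible_potentials[of h S j] potentials_served by fastforce
  qed
  then show ?thesis by (simp add: served_value_def sum.distrib)
qed

lemma expectation_num_matches:
  assumes "feasible I J K P1 h S"
  shows "measure_pmf.expectation (response_pmf U \<phi> S) (\<lambda>r. real (num_matches I J P1 h S r)) =
    (\<Sum>j\<in>J. \<Sum>i\<in>S j. \<phi> j i)"
proof -
  have fin: "finite (S l)" if "l \<in> U" for l using that assms by (rule feasible_finite[rotated])
  have SI: "S j \<subseteq> I" if "j \<in> J" for j using feasible_P1[OF assms, of j] P1_J[of j] that by auto
  have num: "real (num_matches I J P1 h S r) = (\<Sum>j\<in>J. \<Sum>i\<in>S j. of_bool (r (j, i)))" for r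
  proof -
    have "{(i, j). i \<in> I \<and> j \<in> J \<and> i \<in> S j \<and> i \<in> backlog U P1 h j \<and> r (j, i)} =
      prod.swap ` (Sigma J (\<lambda>j. {i \<in> S j. r (j, i)}))"
      using SI feasible_backlog[OF assms] by (auto simp: image_def)
    then have "num_matches I J P1 h S r = card (Sigma J (\<lambda>j. {i \<in> S j. r (j, i)}))"
      unfolding num_matches_def by (simp add: card_image)
    also have "\<dots> = (\<Sum>j\<in>J. card {i \<in> S j. r (j, i)})"
      using finite_J fin by (intro card_SigmaI) auto
    finally show ?thesis
      using fin by (simp add: of_bool_def sum.If_cases Int_def)
  qed
  have resp: "measure_pmf.expectation (response_pmf U \<phi> S) (\<lambda>r. of_bool (r (j, i))) = \<phi> j i"
    if "j \<in> J" "i \<in> S j" for i j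
  proof -
    have "measure_pmf.expectation (response_pmf U \<phi> S) (\<lambda>r. of_bool (r (j, i)) :: real) =
      measure_pmf.expectation (map_pmf (\<lambda>r. r (j, i)) (response_pmf U \<phi> S)) of_bool"
      by simp
    also have "\<dots> = \<phi> j i"
      using that fin finite_U \<phi>_bounds[of j i] SI[OF that(1)]
      by (subst response_pmf_component) (auto simp: subset_iff)
    finally show ?thesis .
  qed
  have int: "integrable (measure_pmf (response_pmf U \<phi> S)) g" for g :: "_ \<Rightarrow> real"
    using finite_response[OF assms] by (rule integrable_measure_pmf_finite)
  show ?thesis unfolding num by (simp add: int resp)
qed

text \<open>Given the history, a profile \<open>i\<close> shown to \<open>j\<close> yields a match
  with probability \<open>\<phi> j i\<close>. Averaging over the current answers replaces realized
  matches by a weight determined by the displays alone.\<close>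

lemma expectation_total_matches:
  assumes "adaptive_policy I J K P1 \<phi> T \<pi>" "t \<le> T"
  shows "measure_pmf.expectation (run U \<phi> \<pi> t) (\<lambda>h. real (total_matches I J P1 h)) =
    measure_pmf.expectation (run U \<phi> \<pi> t) served_value"
  using assms(2)
proof (induction t)
  case 0
  show ?case by (simp add: served_value_def)
next
  case (Suc t)
  let ?R = "measure_pmf.expectation (run U \<phi> \<pi> t)"
  let ?gain = "\<lambda>h. \<Sum>j\<in>J. \<Sum>i\<in>\<pi> h j. \<phi> j i"
  have feas: "feasible I J K P1 h (\<pi> h)" if "h \<in> set_pmf (run U \<phi> \<pi> t)" for h
    using that assms(1) Suc.prems by (intro adaptive_feasible) auto
  have int: "integrable (measure_pmf (run U \<phi> \<pi> t)) g" for g :: "_ \<Rightarrow> real"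
    using finite_set_run[OF assms(1)] Suc.prems by (intro integrable_measure_pmf_finite) auto
  have "measure_pmf.expectation (run U \<phi> \<pi> (Suc t)) (\<lambda>h. real (total_matches I J P1 h)) =
     ?R (\<lambda>h. real (total_matches I J P1 h) + ?gain h)"
  proof (subst expectation_run_Suc[OF assms(1)], goal_cases)
    case 2
    show ?case
    proof (rule expectation_run_cong[OF assms(1)])
      fix h assume h: "h \<in> set_pmf (run U \<phi> \<pi> t)"
      have "integrable (measure_pmf (response_pmf U \<phi> (\<pi> h))) g" for g :: "_ \<Rightarrow> real"
        using finite_response[OF feas[OF h]] by (rule integrable_measure_pmf_finite)
      then show "measure_pmf.expectation (response_pmf U \<phi> (\<pi> h))
          (\<lambda>r. real (total_matches I J P1 ((\<pi> h, r) # h))) = real (total_matches I J P1 h) + ?gain h"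
        using expectation_num_matches[OF feas[OF h]] by simp
    qed (use Suc.prems in auto)
  qed (use Suc.prems in auto)
  also have "\<dots> = ?R served_value + ?R ?gain" using Suc by (simp add: int)
  also have "\<dots> = ?R (\<lambda>h. served_value h + ?gain h)" by (simp add: int)
  also have "\<dots> = measure_pmf.expectation (run U \<phi> \<pi> (Suc t)) served_value"
  proof (subst expectation_run_Suc[OF assms(1)], goal_cases)
    case 2
    show ?case
    proof (rule expectation_run_cong[OF assms(1)])
      fix h assume h: "h \<in> set_pmf (run U \<phi> \<pi> t)" "admissible h"
      then show "served_value h + ?gain h =
          measure_pmf.expectation (response_pmf U \<phi> (\<pi> h)) (\<lambda>r. served_value ((\<pi> h, r) # h))"
        using feas[OF h(1)] by (simp add: served_value_Cons)
    qed (use Suc.prems in auto)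
  qed (use Suc.prems in auto)
  finally show ?case .
qed

section \<open>Pathwise comparison with the queue\<close>

definition level_arrivals :: "'u \<Rightarrow> real \<Rightarrow> ('u \<Rightarrow> nat) \<Rightarrow> nat \<Rightarrow> nat" where
  "level_arrivals j \<theta> a t = card {i \<in> I. a i < t \<and> \<theta> \<le> \<phi> j i}"

lemma level_count_arrivals:
  assumes "t \<le> T"
  shows "level_count (\<phi> j) \<theta> (arrivals I T a) t = level_arrivals j \<theta> a t"
proof -
  have "{(i, s) \<in> arrivals I T a. s < t \<and> \<theta> \<le> \<phi> j i} =
      (\<lambda>i. (i, a i)) ` {i \<in> I. a i < t \<and> \<theta> \<le> \<phi> j i}"
    using assms by (auto simp: arrivals_def)
  then show ?thesis
    unfolding level_count_def level_arrivals_def by (simp add: card_image inj_on_def)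
qed

text \<open>Likes of the newest period carry the index \<open>length h\<close>, and the queue at
  \<open>Suc (length h)\<close> looks only at arrivals before \<open>length h\<close>. Earlier
  arrivals are not overwritten, because a profile in a feasible display has not been shown to that
  user before.\<close>

lemma queue_Cons:
  assumes "admissible ((S, r) # h)" "length h \<le> T"
  shows "queue k (level_arrivals j \<theta> (arrival T ((S, r) # h) j)) (Suc (length h)) =
    min (level_arrivals j \<theta> (arrival T h j) (length h))
      (queue k (level_arrivals j \<theta> (arrival T h j)) (length h) + k)"
proof -
  have iff: "arrival T ((S, r) # h) j i < u \<longleftrightarrow> arrival T h j i < u" if "i \<in> I" "u \<le> length h" for i u
    using that assms arrival_fresh[of j U P1 h i T] feasible_potentials[of h S i] by auto
  have eq: "level_arrivals j \<theta> (arrival T ((S, r) # h) j) u = level_arrivals j \<theta> (arrival T h j) u"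
    if "u \<le> length h" for u
  proof -
    have "{i \<in> I. arrival T ((S, r) # h) j i < u \<and> \<theta> \<le> \<phi> j i} =
        {i \<in> I. arrival T h j i < u \<and> \<theta> \<le> \<phi> j i}"
      using iff[OF _ that] by blast
    then show ?thesis unfolding level_arrivals_def by (rule arg_cong)
  qed
  show ?thesis using eq queue_cong[of "length h", OF eq] by simp
qed

lemma served_arrival:
  assumes "admissible h" "j \<in> J" "i \<in> served h j"
  shows "arrival T h j i < length h"
  using assms
proof (induction h rule: admissible.induct)
  case (2 S r h)
  then have "i \<in> S j \<Longrightarrow> arrival T h j i < length h"
    using feasible_backlog[of h S j] backlog_arrival[of i U P1 h j T] by auto
  with 2 show ?case by (auto intro: less_SucI)
qed simp

text \<open>No feasible play beats the queue at any threshold: a period serves at most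
  \<open>K j\<close> profiles, and whatever is served in it had entered the backlog in an earlier
  period. These are the two arguments of the minimum.\<close>

lemma served_le_queue:
  assumes "admissible h" "length h \<le> T" "j \<in> J"
  shows "card {i \<in> served h j. \<theta> \<le> \<phi> j i} \<le>
    queue (K j) (level_arrivals j \<theta> (arrival T h j)) (length h)"
  using assms
proof (induction h rule: admissible.induct)
  case (2 S r h)
  have feas: "feasible I J K P1 h S" using 2 by simp
  have fin: "finite (S j)" using feasible_finite[OF feas] 2 by simp
  have "card {i \<in> served h j \<union> S j. \<theta> \<le> \<phi> j i} \<le>
      card ({i \<in> served h j. \<theta> \<le> \<phi> j i} \<union> {i \<in> S j. \<theta> \<le> \<phi> j i})"
    using finite_served[of h j] 2 fin by (intro card_mono) auto
  also have "\<dots> \<le> card {i \<in> served h j. \<theta> \<le> \<phi> j i} + card {i \<in> S j. \<theta> \<le> \<phi> j i}"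
    by (rule card_Un_le)
  also have "card {i \<in> S j. \<theta> \<le> \<phi> j i} \<le> K j"
  proof (rule order_trans)
    show "card {i \<in> S j. \<theta> \<le> \<phi> j i} \<le> card (S j)" using fin by (intro card_mono) auto
    show "card (S j) \<le> K j" using feas 2(4) unfolding feasible_def by blast
  qed
  finally have 1: "card {i \<in> served h j \<union> S j. \<theta> \<le> \<phi> j i} \<le>
      queue (K j) (level_arrivals j \<theta> (arrival T h j)) (length h) + K j"
    using 2 by simp
  have sub: "served h j \<union> S j \<subseteq> {i \<in> I. arrival T h j i < length h}"
  proof -
    have "S j \<subseteq> I" using feasible_P1[OF feas] P1_J 2 by blast
    moreover have "arrival T h j i < length h" if "i \<in> S j" for i
      using that feasible_backlog[OF feas] backlog_arrival[of i U P1 h j T] 2 by auto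
    ultimately show ?thesis using served_subset[of h j] served_arrival[of h j] 2 by auto
  qed
  have "card {i \<in> served h j \<union> S j. \<theta> \<le> \<phi> j i} \<le> level_arrivals j \<theta> (arrival T h j) (length h)"
    unfolding level_arrivals_def using sub finite_I by (intro card_mono) auto
  moreover have "length h \<le> T" using 2 by simp
  ultimately show ?case
    unfolding served.simps length_Cons queue_Cons[OF 2(2) \<open>length h \<le> T\<close>] using 1
    by (intro min.boundedI)
qed simp

definition column_value :: "'u \<Rightarrow> ('u \<Rightarrow> nat) \<Rightarrow> real" where
  "column_value j a = queue_value I (\<phi> j) (K j) T (arrivals I T a)"

lemma column_value_eq:
  "column_value j a = (\<Sum>\<theta>\<in>\<phi> j ` I. layer_gap (\<phi> j ` I) \<theta> * real (queue (K j) (level_arrivals j \<theta> a) T))"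
proof -
  have "queue (K j) (level_count (\<phi> j) \<theta> (arrivals I T a)) T = queue (K j) (level_arrivals j \<theta> a) T" for \<theta>
    by (rule queue_cong) (simp add: level_count_arrivals)
  then show ?thesis by (simp add: column_value_def queue_value_def)
qed

lemma layer_gap_\<phi>: "j \<in> J \<Longrightarrow> 0 \<le> layer_gap (\<phi> j ` I) \<theta>"
  using \<phi>_bounds finite_I by (intro layer_gap_nonneg) auto

lemma served_value_layers:
  assumes "admissible h" "j \<in> J"
  shows "(\<Sum>i\<in>served h j. \<phi> j i) =
    (\<Sum>\<theta>\<in>\<phi> j ` I. layer_gap (\<phi> j ` I) \<theta> * real (card {i \<in> served h j. \<theta> \<le> \<phi> j i}))"
  by (rule sum_layers[OF finite_I _ served_subset[OF assms]]) (use assms \<phi>_bounds in auto)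

text \<open>The domination holds history by history, so it does not matter how the policy correlates
  its displays with the arrivals.\<close>

lemma adaptive_upper_bound:
  assumes "adaptive_policy I J K P1 \<phi> T \<pi>"
  shows "measure_pmf.expectation (run U \<phi> \<pi> T) (\<lambda>h. real (total_matches I J P1 h)) \<le>
    (\<Sum>j\<in>J. measure_pmf.expectation (run U \<phi> \<pi> T) (\<lambda>h. column_value j (arrival T h j)))"
proof -
  have "measure_pmf.expectation (run U \<phi> \<pi> T) (\<lambda>h. real (total_matches I J P1 h)) \<le>
     measure_pmf.expectation (run U \<phi> \<pi> T) (\<lambda>h. \<Sum>j\<in>J. column_value j (arrival T h j))"
    unfolding expectation_total_matches[OF assms order_refl]
  proof (rule expectation_run_mono[OF assms order_refl])
    fix h assume h: "admissible h" "length h = T"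
    have "(\<Sum>i\<in>served h j. \<phi> j i) \<le> column_value j (arrival T h j)" if j: "j \<in> J" for j
      unfolding column_value_eq served_value_layers[OF h(1) j]
      using served_le_queue[OF h(1) _ j] h(2) layer_gap_\<phi>[OF j]
      by (intro sum_mono mult_left_mono of_nat_mono) auto
    then show "served_value h \<le> (\<Sum>j\<in>J. column_value j (arrival T h j))"
      unfolding served_value_def by (rule sum_mono)
  qed
  also have "\<dots> = (\<Sum>j\<in>J. measure_pmf.expectation (run U \<phi> \<pi> T) (\<lambda>h. column_value j (arrival T h j)))"
    using finite_set_run[OF assms order_refl]
    by (intro Bochner_Integration.integral_sum integrable_measure_pmf_finite)
  finally show ?thesis .
qed

subsection \<open>Greedy policies for fixed schedules\<close>

text \<open>Disjointness over time keeps a scheduled profile among the potentials until its turn.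
  Emptiness outside the relevant index set makes the set of schedules finite, so that a best one
  exists.\<close>

definition schedules :: "('u \<times> nat \<Rightarrow> 'u set) set" where
  "schedules = {\<sigma>. (\<forall>i\<in>I. \<forall>t. \<sigma> (i, t) \<subseteq> P1 i \<and> card (\<sigma> (i, t)) \<le> K i) \<and>
     (\<forall>i\<in>I. \<forall>s t. s \<noteq> t \<longrightarrow> \<sigma> (i, s) \<inter> \<sigma> (i, t) = {}) \<and>
     (\<forall>i t. (i, t) \<notin> I \<times> {..<T} \<longrightarrow> \<sigma> (i, t) = {})}"

lemma schedules_subset: "\<sigma> \<in> schedules \<Longrightarrow> i \<in> I \<Longrightarrow> \<sigma> (i, t) \<subseteq> P1 i"
  and schedules_card: "\<sigma> \<in> schedules \<Longrightarrow> i \<in> I \<Longrightarrow> card (\<sigma> (i, t)) \<le> K i"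
  and schedules_once: "\<sigma> \<in> schedules \<Longrightarrow> i \<in> I \<Longrightarrow> j \<in> \<sigma> (i, s) \<Longrightarrow> j \<in> \<sigma> (i, t) \<Longrightarrow> s = t"
  unfolding schedules_def by blast+

lemma finite_schedules: "finite schedules"
proof (rule finite_subset)
  show "schedules \<subseteq> {\<sigma>. \<forall>x. (x \<in> I \<times> {..<T} \<longrightarrow> \<sigma> x \<in> Pow J) \<and> (x \<notin> I \<times> {..<T} \<longrightarrow> \<sigma> x = {})}"
    using P1_I by (force simp: schedules_def)
  show "finite {\<sigma>. \<forall>x. (x \<in> I \<times> {..<T} \<longrightarrow> \<sigma> x \<in> Pow J) \<and> (x \<notin> I \<times> {..<T} \<longrightarrow> \<sigma> x = {})}"
    using finite_I finite_J by (intro finite_set_of_finite_funs) auto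
qed

lemma empty_schedule: "(\<lambda>_. {}) \<in> schedules"
  by (auto simp: schedules_def)

definition greedy :: "('u \<times> nat \<Rightarrow> 'u set) \<Rightarrow> 'u policy" where
  "greedy \<sigma> h l = (if l \<in> I then \<sigma> (l, length h)
     else if l \<in> J then top_subset (K l) (\<phi> l) (backlog U P1 h l) else {})"

fun follows :: "('u \<times> nat \<Rightarrow> 'u set) \<Rightarrow> 'u history \<Rightarrow> bool" where
  "follows \<sigma> [] = True"
| "follows \<sigma> ((S, r) # h) \<longleftrightarrow> follows \<sigma> h \<and> S = greedy \<sigma> h"

lemma follows_run: "h \<in> set_pmf (run U \<phi> (greedy \<sigma>) t) \<Longrightarrow> follows \<sigma> h"
  by (induction t arbitrary: h) auto

lemma greedy_I: "i \<in> I \<Longrightarrow> greedy \<sigma> h i = \<sigma> (i, length h)"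
  by (simp add: greedy_def)

lemma greedy_J: "j \<in> J \<Longrightarrow> greedy \<sigma> h j = top_subset (K j) (\<phi> j) (backlog U P1 h j)"
  using disjoint by (auto simp: greedy_def)

lemma finite_backlog: "j \<in> J \<Longrightarrow> finite (backlog U P1 h j)"
  by (rule finite_subset[OF backlog_subset[of _ P1]]) (simp add: finite_P1)

lemma greedy_backlog: "j \<in> J \<Longrightarrow> greedy \<sigma> h j \<subseteq> backlog U P1 h j"
  by (simp add: greedy_J top_subset_subset finite_backlog)

text \<open>Before its scheduled period nothing happens to the pair on either side: the schedule
  shows \<open>j\<close> to \<open>i\<close> only once, and \<open>j\<close> sees only backlog
  profiles, which \<open>i\<close> joins only by liking \<open>j\<close>. The three claims support
  each other in the induction.\<close>

lemma follows_undisplayed: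
  assumes "\<sigma> \<in> schedules" "follows \<sigma> h" "i \<in> I" "j \<in> \<sigma> (i, s)" "length h \<le> s"
  shows "j \<in> potentials U P1 h i \<and> i \<in> potentials U P1 h j \<and> i \<notin> backlog U P1 h j"
  using assms(2,5)
proof (induction h)
  case Nil
  have "j \<in> P1 i" using assms schedules_subset by blast
  moreover have "j \<in> J" using calculation P1_I assms by blast
  ultimately show ?case using P1_sym[of i j] assms by auto
next
  case (Cons x h)
  obtain S r where x: "x = (S, r)" by (cases x)
  have IH: "j \<in> potentials U P1 h i" "i \<in> potentials U P1 h j" "i \<notin> backlog U P1 h j"
    and S: "S = greedy \<sigma> h" and len: "length h < s" using Cons by (auto simp: x)
  have j: "j \<in> J" using assms schedules_subset P1_I by blast
  have "j \<notin> S i"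
    using schedules_once[OF assms(1,3,4), of "length h"] len S assms(3) by (auto simp: greedy_I)
  moreover have "i \<notin> S j" using IH(3) greedy_backlog[OF j] S by auto
  ultimately show ?case using IH by (auto simp: x likers_def dislikers_def)
qed

text \<open>A dislike could remove a backlog profile \<open>i\<close> from the potentials of
  \<open>j\<close> only if \<open>i\<close> were shown \<open>j\<close> again. By
  \<open>follows_undisplayed\<close> a profile about to be shown is not yet in the backlog, so this
  cannot happen.\<close>

lemma follows_backlog_potentials:
  assumes "\<sigma> \<in> schedules" "follows \<sigma> h" "j \<in> J" "i \<in> backlog U P1 h j"
  shows "i \<in> potentials U P1 h j"
  using assms(2,4)
proof (induction h)
  case (Cons x h)
  obtain S r where x: "x = (S, r)" by (cases x)
  have i: "i \<in> I" using subsetD[OF backlog_subset Cons.prems(2)] P1_J[OF assms(3)] by (rule subsetD[rotated])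
  have h: "follows \<sigma> h" "S = greedy \<sigma> h" using Cons.prems(1) by (simp_all add: x)
  have S: "i \<notin> S j" "i \<in> backlog U P1 h j \<or> i \<in> potentials U P1 h j \<and> i \<in> likers U S r j"
    using Cons.prems(2) by (simp_all add: x)
  have "j \<notin> S i" if "i \<in> backlog U P1 h j"
    using follows_undisplayed[OF assms(1) h(1) i, of j "length h"] that
    by (auto simp: h(2) greedy_I[OF i])
  then have "i \<notin> dislikers U S r j" using S(2) by (auto simp: likers_def dislikers_def)
  moreover have "i \<in> potentials U P1 h j" using S(2) Cons.IH[OF h(1)] by blast
  ultimately show ?case using S(1) by (simp add: x)
qed simp

lemma follows_feasible:
  assumes \<sigma>: "\<sigma> \<in> schedules" and h: "follows \<sigma> h"
  shows "feasible I J K P1 h (greedy \<sigma> h)"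
proof -
  have undisp: "j \<in> J \<and> j \<in> potentials U P1 h i \<and> i \<notin> greedy \<sigma> h j"
    if "i \<in> I" "j \<in> greedy \<sigma> h i" for i j
  proof -
    have j: "j \<in> \<sigma> (i, length h)" "j \<in> J"
      using that schedules_subset[OF \<sigma> that(1)] P1_I[OF that(1)] by (auto simp: greedy_I)
    then show ?thesis
      using follows_undisplayed[OF \<sigma> h that(1) j(1)] greedy_backlog[OF j(2), of \<sigma> h] by auto
  qed
  have backlog: "greedy \<sigma> h j \<subseteq> potentials U P1 h j" if "j \<in> J" for j
    using greedy_backlog[OF that] follows_backlog_potentials[OF \<sigma> h that] by (auto dest: subsetD)
  have JI: "greedy \<sigma> h j \<subseteq> I" if "j \<in> J" for j
    using order_trans[OF backlog[OF that] potentials_subset] P1_J[OF that] by (rule order_trans)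
  have cards: "card (greedy \<sigma> h l) \<le> K l" if "l \<in> U" for l
  proof (cases "l \<in> I")
    case True
    with schedules_card[OF \<sigma> True] show ?thesis by (simp add: greedy_I)
  next
    case False
    with that have "l \<in> J" by simp
    then show ?thesis by (simp add: greedy_J card_top_subset finite_backlog)
  qed
  have "\<not> (l' \<in> greedy \<sigma> h l \<and> l \<in> greedy \<sigma> h l')" if "l \<in> U" "l' \<in> U" for l l'
  proof
    assume seen: "l' \<in> greedy \<sigma> h l \<and> l \<in> greedy \<sigma> h l'"
    show False
    proof (cases "l \<in> I")
      case True
      with undisp[of l l'] seen show False by simp
    next
      case False
      then have "l' \<in> I" using that(1) JI[of l] seen by auto
      with undisp[of l' l] seen show False by simp
    qed
  qed
  moreover have "greedy \<sigma> h l \<subseteq> potentials U P1 h l" if "l \<in> U" for l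
  proof (cases "l \<in> I")
    case True
    then show ?thesis using undisp[OF True] by auto
  next
    case False
    with that show ?thesis using backlog[of l] by simp
  qed
  ultimately show ?thesis
    unfolding feasible_def using cards greedy_backlog by simp
qed

lemma greedy_adaptive: "\<sigma> \<in> schedules \<Longrightarrow> adaptive_policy I J K P1 \<phi> T (greedy \<sigma>)"
  unfolding adaptive_policy_def using follows_feasible follows_run by blast

lemma greedy_semi_adaptive:
  "\<sigma> \<in> schedules \<Longrightarrow> semi_adaptive_policy I J K P1 \<phi> T (greedy \<sigma>)"
  unfolding semi_adaptive_policy_def by (simp add: greedy_adaptive greedy_I)

lemma follows_admissible: "\<sigma> \<in> schedules \<Longrightarrow> follows \<sigma> h \<Longrightarrow> admissible h"
proof (induction h)
  case (Cons x h)
  then show ?case using follows_feasible[of \<sigma> h] by (cases x) auto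
qed simp

lemma arrival_in_backlog:
  assumes "\<sigma> \<in> schedules" "follows \<sigma> h" "i \<in> I" "j \<in> J" "arrival T h j i < T" "i \<notin> served h j"
  shows "i \<in> backlog U P1 h j"
  using assms(2,5,6)
proof (induction h)
  case (Cons x h)
  obtain S r where x: "x = (S, r)" by (cases x)
  show ?case
  proof (cases "j \<in> S i \<and> r (i, j)")
    case True
    then have "i \<in> potentials U P1 h j"
      using follows_undisplayed[OF assms(1) _ assms(3), of h j "length h"] Cons.prems(1)
      by (auto simp: x greedy_I[OF assms(3)])
    with True Cons.prems(3) assms(3) show ?thesis by (auto simp: x likers_def)
  next
    case False
    with Cons show ?thesis by (auto simp: x)
  qed
qed simp

text \<open>Greedy attains the bound of \<open>served_le_queue\<close> at every threshold: past
  arrivals of the level are served or in the backlog, and the current display either takes all of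
  that part of the backlog or contains at least \<open>K j\<close> profiles of the level.\<close>

lemma queue_le_served:
  assumes \<sigma>: "\<sigma> \<in> schedules" and "follows \<sigma> h" "length h \<le> T" "j \<in> J"
  shows "queue (K j) (level_arrivals j \<theta> (arrival T h j)) (length h) \<le>
    card {i \<in> served h j. \<theta> \<le> \<phi> j i}"
  using assms(2,3)
proof (induction h)
  case (Cons x h)
  obtain S r where x: "x = (S, r)" by (cases x)
  let ?B = "backlog U P1 h j"
  have h: "follows \<sigma> h" "length h \<le> T" "S = greedy \<sigma> h" and len: "length h < T"
    using Cons.prems by (auto simp: x)
  have adm: "admissible ((S, r) # h)" "admissible h"
    using follows_admissible[OF \<sigma> Cons.prems(1)] by (auto simp: x)
  have fin: "finite (served h j)" "finite ?B" "finite (S j)"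
    using finite_served[OF adm(2) \<open>j \<in> J\<close>] finite_backlog[OF \<open>j \<in> J\<close>]
      feasible_finite[of h S j] adm \<open>j \<in> J\<close> by auto
  have disj: "served h j \<inter> S j = {}"
    using feasible_potentials[of h S j] adm \<open>j \<in> J\<close> potentials_served by fastforce
  have "{i \<in> I. arrival T h j i < length h \<and> \<theta> \<le> \<phi> j i} \<subseteq>
      {i \<in> served h j. \<theta> \<le> \<phi> j i} \<union> {i \<in> ?B. \<theta> \<le> \<phi> j i}"
    using arrival_in_backlog[OF \<sigma> h(1) _ \<open>j \<in> J\<close>] h(2) by (auto dest: order.strict_trans2)
  then have "level_arrivals j \<theta> (arrival T h j) (length h) \<le>
      card ({i \<in> served h j. \<theta> \<le> \<phi> j i} \<union> {i \<in> ?B. \<theta> \<le> \<phi> j i})"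
    unfolding level_arrivals_def using fin by (intro card_mono) auto
  also have "\<dots> \<le> card {i \<in> served h j. \<theta> \<le> \<phi> j i} + card {i \<in> ?B. \<theta> \<le> \<phi> j i}"
    by (rule card_Un_le)
  finally have 1: "level_arrivals j \<theta> (arrival T h j) (length h) \<le> \<dots>" .
  have 2: "min (K j) (card {i \<in> ?B. \<theta> \<le> \<phi> j i}) \<le> card {i \<in> S j. \<theta> \<le> \<phi> j i}"
    unfolding h(3) greedy_J[OF \<open>j \<in> J\<close>] by (rule card_top_subset_level[OF fin(2)])
  have "{i \<in> served h j \<union> S j. \<theta> \<le> \<phi> j i} =
      {i \<in> served h j. \<theta> \<le> \<phi> j i} \<union> {i \<in> S j. \<theta> \<le> \<phi> j i}" by auto
  then have 3: "card {i \<in> served h j \<union> S j. \<theta> \<le> \<phi> j i} =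
      card {i \<in> served h j. \<theta> \<le> \<phi> j i} + card {i \<in> S j. \<theta> \<le> \<phi> j i}"
    using fin disj by (simp only:, intro card_Un_disjoint) auto
  have IH: "queue (K j) (level_arrivals j \<theta> (arrival T h j)) (length h) \<le>
      card {i \<in> served h j. \<theta> \<le> \<phi> j i}"
    using Cons.IH h by simp
  show ?case
    unfolding x length_Cons served.simps queue_Cons[OF adm(1) h(2)] 3
    using 1 2 IH by (simp add: min_def split: if_splits)
qed simp

lemma greedy_lower_bound:
  assumes "\<sigma> \<in> schedules"
  shows "(\<Sum>j\<in>J. measure_pmf.expectation (run U \<phi> (greedy \<sigma>) T) (\<lambda>h. column_value j (arrival T h j))) \<le>
    measure_pmf.expectation (run U \<phi> (greedy \<sigma>) T) (\<lambda>h. real (total_matches I J P1 h))"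
proof -
  note adaptive = greedy_adaptive[OF assms]
  have "(\<Sum>j\<in>J. measure_pmf.expectation (run U \<phi> (greedy \<sigma>) T) (\<lambda>h. column_value j (arrival T h j))) =
     measure_pmf.expectation (run U \<phi> (greedy \<sigma>) T) (\<lambda>h. \<Sum>j\<in>J. column_value j (arrival T h j))"
    using finite_set_run[OF adaptive order_refl]
    by (intro Bochner_Integration.integral_sum[symmetric] integrable_measure_pmf_finite)
  also have "\<dots> \<le> measure_pmf.expectation (run U \<phi> (greedy \<sigma>) T) (\<lambda>h. real (total_matches I J P1 h))"
    unfolding expectation_total_matches[OF adaptive order_refl]
  proof (rule expectation_run_mono[OF adaptive order_refl])
    fix h assume h: "admissible h" "length h = T" "h \<in> set_pmf (run U \<phi> (greedy \<sigma>) T)"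
    have "column_value j (arrival T h j) \<le> (\<Sum>i\<in>served h j. \<phi> j i)" if j: "j \<in> J" for j
      unfolding column_value_eq served_value_layers[OF h(1) j]
      using queue_le_served[OF assms follows_run[OF h(3)] _ j] h(2) layer_gap_\<phi>[OF j]
      by (intro sum_mono mult_left_mono of_nat_mono) auto
    then show "(\<Sum>j\<in>J. column_value j (arrival T h j)) \<le> served_value h"
      unfolding served_value_def by (rule sum_mono)
  qed
  finally show ?thesis .
qed

subsection \<open>Copying the schedule of an adaptive policy\<close>

text \<open>Displays to \<open>I\<close> no longer depend on answers, so each period updates the
  arrival times of different users by independent coins. The value \<open>T\<close> outside
  \<open>I\<close> matches the default of the product, which makes this an equality of
  distributions.\<close>

lemma greedy_arrival_law:
  assumes \<sigma>: "\<sigma> \<in> schedules"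
  shows "map_pmf (\<lambda>h i. if i \<in> I then arrival T h j i else T) (run U \<phi> (greedy \<sigma>) t) =
    Pi_pmf I T (\<lambda>i. arrival_law T (\<phi> i j) j (\<lambda>s. \<sigma> (i, s)) t)"
proof (induction t)
  case 0
  have "(\<lambda>i. if i \<in> I then arrival T [] j i else T) = (\<lambda>_. T)" by auto
  then show ?case using finite_I by simp
next
  case (Suc t)
  let ?a = "\<lambda>h i. if i \<in> I then arrival T h j i else T"
  let ?like = "\<lambda>i. if j \<in> \<sigma> (i, t) then bernoulli_pmf (\<phi> i j) else return_pmf False"
  let ?upd = "\<lambda>R. Pi_pmf I T (\<lambda>i. map_pmf (\<lambda>b. if b then t else R i) (?like i))"
  have "map_pmf ?a (run U \<phi> (greedy \<sigma>) (Suc t)) = bind_pmf (run U \<phi> (greedy \<sigma>) t)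
     (\<lambda>h. map_pmf (\<lambda>r. ?a ((greedy \<sigma> h, r) # h)) (response_pmf U \<phi> (greedy \<sigma> h)))"
    by (simp add: map_bind_pmf map_pmf_comp)
  also have "\<dots> = bind_pmf (run U \<phi> (greedy \<sigma>) t) (\<lambda>h. ?upd (?a h))"
  proof (intro bind_pmf_cong refl)
    fix h assume h: "h \<in> set_pmf (run U \<phi> (greedy \<sigma>) t)"
    have len: "length h = t" using length_run[OF h] .
    have fin: "finite (greedy \<sigma> h l)" if "l \<in> U" for l
      using feasible_finite[OF follows_feasible[OF \<sigma> follows_run[OF h]] that] .
    have "map_pmf (\<lambda>r. ?a ((greedy \<sigma> h, r) # h)) (response_pmf U \<phi> (greedy \<sigma> h)) =
      map_pmf (\<lambda>r i. if i \<in> I then (\<lambda>b. if b then t else ?a h i) (j \<in> greedy \<sigma> h i \<and> r (i, j)) else T)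
        (response_pmf U \<phi> (greedy \<sigma> h))"
      by (intro map_pmf_cong refl) (simp add: len fun_eq_iff)
    also have "\<dots> = Pi_pmf I T (\<lambda>i. map_pmf (\<lambda>b. if b then t else ?a h i)
        (if j \<in> greedy \<sigma> h i then bernoulli_pmf (\<phi> i j) else return_pmf False))"
      by (rule response_pmf_column[OF finite_U fin]) auto
    also have "\<dots> = ?upd (?a h)"
      by (intro Pi_pmf_cong refl) (simp add: greedy_I len)
    finally show "map_pmf (\<lambda>r. ?a ((greedy \<sigma> h, r) # h)) (response_pmf U \<phi> (greedy \<sigma> h)) = ?upd (?a h)" .
  qed
  also have "\<dots> = bind_pmf (map_pmf ?a (run U \<phi> (greedy \<sigma>) t)) ?upd"
    by (simp add: bind_map_pmf)
  also have "\<dots> = Pi_pmf I T (\<lambda>i. arrival_law T (\<phi> i j) j (\<lambda>s. \<sigma> (i, s)) (Suc t))"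
    unfolding Suc.IH arrival_law.simps by (rule Pi_pmf_bind[OF finite_I, symmetric])
  finally show ?case .
qed

lemma expectation_greedy_column:
  assumes "\<sigma> \<in> schedules"
  shows "measure_pmf.expectation (run U \<phi> (greedy \<sigma>) T) (\<lambda>h. column_value j (arrival T h j)) =
    measure_pmf.expectation (Pi_pmf I T (\<lambda>i. arrival_law T (\<phi> i j) j (\<lambda>s. \<sigma> (i, s)) T)) (column_value j)"
proof -
  have "column_value j (\<lambda>i. if i \<in> I then arrival T h j i else T) = column_value j (arrival T h j)" for h
    unfolding column_value_def by (intro arg_cong[of _ _ "queue_value I (\<phi> j) (K j) T"] arrivals_cong) simp
  then show ?thesis unfolding greedy_arrival_law[OF assms, symmetric] by simp
qed

text \<open>
  In a run of an adaptive policy the displays to \<open>i\<close> after \<open>j\<close> was shown may depend on the answer to \<open>j\<close>, so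
  the arrival time does not have this law conditionally on the displays; only the means agree,
  because the deviation is a martingale.
\<close>

definition deviation :: "(nat \<Rightarrow> real) \<Rightarrow> 'u \<Rightarrow> 'u \<Rightarrow> 'u history \<Rightarrow> real" where
  "deviation g j i h = g (arrival T h j i) -
     measure_pmf.expectation (arrival_law T (\<phi> i j) j (\<lambda>s. displayed h s i) (length h)) g"

text \<open>If \<open>j\<close> is shown to \<open>i\<close>, it is for the first time: both the
  true time and the law are still at \<open>T\<close>, and the same coin updates both. If
  \<open>j\<close> is not shown, neither changes.\<close>

lemma expectation_deviation:
  assumes feas: "feasible I J K P1 h S" and i: "i \<in> I"
  shows "measure_pmf.expectation (response_pmf U \<phi> S) (\<lambda>r. deviation g j i ((S, r) # h)) = deviation g j i h"
proof -
  let ?t = "length h"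
  let ?law = "\<lambda>h. arrival_law T (\<phi> i j) j (\<lambda>s. displayed h s i)"
  let ?like = "if j \<in> S i then bernoulli_pmf (\<phi> i j) else return_pmf False"
  have "?law ((S, r) # h) ?t = ?law h ?t" for r
    by (rule arrival_law_cong) simp
  then have law: "?law ((S, r) # h) (Suc ?t) =
      bind_pmf (?law h ?t) (\<lambda>x. map_pmf (\<lambda>b. if b then ?t else x) ?like)" for r by simp
  have deviation_Cons: "deviation g j i ((S, r) # h) =
      g (if j \<in> S i \<and> r (i, j) then ?t else arrival T h j i) - measure_pmf.expectation
        (bind_pmf (?law h ?t) (\<lambda>x. map_pmf (\<lambda>b. if b then ?t else x) ?like)) g" for r
    unfolding deviation_def length_Cons law arrival.simps ..
  show ?thesis
  proof (cases "j \<in> S i")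
    case True
    then have j: "j \<in> potentials U P1 h i" using feasible_potentials[OF feas, of i] i by auto
    have int: "integrable (measure_pmf (response_pmf U \<phi> S)) f" for f :: "_ \<Rightarrow> real"
      using finite_response[OF feas] by (rule integrable_measure_pmf_finite)
    have law_h: "?law h ?t = return_pmf T"
      by (rule arrival_law_undisplayed) (rule potentials_displayed[OF j])
    have "measure_pmf.expectation (response_pmf U \<phi> S) (\<lambda>r. g (if r (i, j) then ?t else T)) =
       measure_pmf.expectation (map_pmf (\<lambda>r. r (i, j)) (response_pmf U \<phi> S)) (\<lambda>b. g (if b then ?t else T))"
      by simp
    also have "\<dots> = measure_pmf.expectation (bernoulli_pmf (\<phi> i j)) (\<lambda>b. g (if b then ?t else T))"
      using i True feasible_finite[OF feas] finite_U by (subst response_pmf_component) auto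
    finally show ?thesis
      unfolding deviation_Cons unfolding deviation_def arrival_fresh[OF j] law_h
      by (simp add: True bind_return_pmf int)
  next
    case False
    then show ?thesis unfolding deviation_Cons by (simp add: deviation_def bind_return_pmf')
  qed
qed

text \<open>For an indicator \<open>g\<close> this says that mixing the laws over the displays of a
  run restores the true marginal of the arrival time, as \<open>correlation_gap\<close>
  requires.\<close>

lemma expectation_arrival:
  assumes \<pi>: "adaptive_policy I J K P1 \<phi> T \<pi>" and i: "i \<in> I"
  shows "measure_pmf.expectation (run U \<phi> \<pi> T) (\<lambda>h. g (arrival T h j i)) =
    measure_pmf.expectation (run U \<phi> \<pi> T)
      (\<lambda>h. measure_pmf.expectation (arrival_law T (\<phi> i j) j (\<lambda>s. displayed h s i) T) (g :: nat \<Rightarrow> real))"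
proof -
  have zero: "measure_pmf.expectation (run U \<phi> \<pi> t) (deviation g j i) = 0" if "t \<le> T" for t
    using that
  proof (induction t)
    case 0
    show ?case by (simp add: deviation_def)
  next
    case (Suc t)
    then have t: "t < T" by simp
    have "measure_pmf.expectation (run U \<phi> \<pi> (Suc t)) (deviation g j i) =
      measure_pmf.expectation (run U \<phi> \<pi> t) (deviation g j i)"
      unfolding expectation_run_Suc[OF \<pi> t]
      by (rule expectation_run_cong[OF \<pi>])
        (use t in \<open>auto intro!: expectation_deviation adaptive_feasible[OF \<pi>] i\<close>)
    with Suc t show ?case by simp
  qed
  have int: "integrable (measure_pmf (run U \<phi> \<pi> T)) f" for f :: "_ \<Rightarrow> real"
    using finite_set_run[OF \<pi> order_refl] by (rule integrable_measure_pmf_finite)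
  have "measure_pmf.expectation (run U \<phi> \<pi> T) (deviation g j i) =
    measure_pmf.expectation (run U \<phi> \<pi> T) (\<lambda>h. g (arrival T h j i) -
      measure_pmf.expectation (arrival_law T (\<phi> i j) j (\<lambda>s. displayed h s i) T) g)"
    by (rule expectation_run_cong[OF \<pi> order_refl]) (simp add: deviation_def)
  then show ?thesis using zero[OF order_refl] by (simp add: int)
qed

lemma displayed_feasible:
  assumes "admissible h" "i \<in> I"
  shows "displayed h t i \<subseteq> P1 i \<and> card (displayed h t i) \<le> K i"
  using assms(1)
proof (induction h rule: admissible.induct)
  case (2 S r h)
  then show ?case
    using feasible_P1[of h S i] assms(2) by (auto simp: feasible_def)
qed simp

lemma displayed_once:
  assumes "admissible h" "i \<in> I" "j \<in> displayed h s i" "j \<in> displayed h t i"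
  shows "s = t"
  using assms(1,3,4)
proof (induction h rule: admissible.induct)
  case (2 S r h)
  have "j \<notin> displayed h u i" if "j \<in> S i" for u
    using that 2 feasible_potentials[of h S i] assms(2) potentials_displayed by fastforce
  with 2 show ?case by (auto split: if_splits)
qed simp

text \<open>Every constraint on a schedule concerns a single user of \<open>I\<close>, so rows read
  off from unrelated histories fit together.\<close>

lemma copied_schedule:
  assumes "\<And>i. i \<in> I \<Longrightarrow> admissible (H i)"
  shows "(\<lambda>(i, t). if i \<in> I \<and> t < T then displayed (H i) t i else {}) \<in> schedules"
  using displayed_feasible[OF assms] displayed_once[OF assms] by (fastforce simp: schedules_def)

lemma exists_good_schedule:
  assumes \<pi>: "adaptive_policy I J K P1 \<phi> T \<pi>"
  shows "\<exists>\<sigma>\<in>schedules.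
    (1 - 1 / exp 1) * measure_pmf.expectation (run U \<phi> \<pi> T) (\<lambda>h. real (total_matches I J P1 h)) \<le>
    measure_pmf.expectation (run U \<phi> (greedy \<sigma>) T) (\<lambda>h. real (total_matches I J P1 h))"
proof -
  let ?run = "run U \<phi> \<pi> T"
  define law where "law j i h = arrival_law T (\<phi> i j) j (\<lambda>s. displayed h s i) T" for j i h
  define Q where "Q = Pi_pmf I [] (\<lambda>_. ?run)"
  let ?col = "\<lambda>j H. measure_pmf.expectation (Pi_pmf I T (\<lambda>i. law j i (H i))) (column_value j)"
  have fin_run: "finite (set_pmf ?run)" using finite_set_run[OF \<pi> order_refl] .
  have fin_Q: "finite (set_pmf Q)" unfolding Q_def using finite_I fin_run by (intro finite_set_Pi_pmf)
  have set_law: "set_pmf (law j i h) \<subseteq> {..T}" for j i h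
    unfolding law_def by (rule set_arrival_law) simp
  have gap: "(1 - 1 / exp 1) * measure_pmf.expectation ?run (\<lambda>h. column_value j (arrival T h j)) \<le>
      measure_pmf.expectation Q (?col j)" if j: "j \<in> J" for j
  proof -
    interpret submodular_arrivals I T "queue_value I (\<phi> j) (K j) T"
      using finite_I \<phi>_bounds j by (intro queue_value_submodular) auto
    have "(1 - 1 / exp 1) * measure_pmf.expectation ?run (\<lambda>h. column_value j (arrival T h j)) \<le>
      measure_pmf.expectation (Pi_pmf I T (\<lambda>i. bind_pmf ?run (law j i))) (column_value j)"
      unfolding column_value_def
    proof (rule correlation_gap[OF fin_run])
      show "set_pmf (bind_pmf ?run (law j i)) \<subseteq> {..T}" for i using set_law by auto
      show "measure_pmf.expectation ?run (\<lambda>h. of_bool (arrival T h j i = t)) =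
          pmf (bind_pmf ?run (law j i)) t" if "i \<in> I" for i t
      proof -
        have "measure_pmf.expectation (law j i h) (\<lambda>x. of_bool (x = t)) = pmf (law j i h) t" for h
          using integral_measure_pmf_real[of "{t}" "law j i h" "\<lambda>x. of_bool (x = t)"] by simp
        then show ?thesis
          using expectation_arrival[OF \<pi> that, of "\<lambda>x. of_bool (x = t)" j]
          by (simp add: pmf_bind law_def)
      qed
    qed
    \<comment> \<open>A product of mixtures is a mixture of products: first draw the runs
      \<open>H\<close>, then fresh answers along the displays copied from them.\<close>
    also have "Pi_pmf I T (\<lambda>i. bind_pmf ?run (law j i)) =
        bind_pmf Q (\<lambda>H. Pi_pmf I T (\<lambda>i. law j i (H i)))"
      unfolding Q_def by (rule Pi_pmf_bind[OF finite_I])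
    also have "measure_pmf.expectation \<dots> (column_value j) = measure_pmf.expectation Q (?col j)"
      using fin_Q finite_I finite_subset[OF set_law]
      by (intro expectation_bind_finite finite_set_Pi_pmf) auto
    finally show ?thesis .
  qed
  \<comment> \<open>Averaging is applied to the sum over \<open>J\<close>, so a single
    \<open>H\<close> serves all columns together; it need not be good for each \<open>j\<close>
    separately.\<close>
  obtain H where H: "H \<in> set_pmf Q"
    "measure_pmf.expectation Q (\<lambda>H. \<Sum>j\<in>J. ?col j H) \<le> (\<Sum>j\<in>J. ?col j H)"
    using expectation_le_some[OF fin_Q] by blast
  define \<sigma> where "\<sigma> = (\<lambda>(i, t). if i \<in> I \<and> t < T then displayed (H i) t i else {})"
  have "H i \<in> set_pmf ?run" if "i \<in> I" for i
    using H(1) that unfolding Q_def set_Pi_pmf[OF finite_I] by (auto simp: PiE_dflt_def)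
  then have \<sigma>: "\<sigma> \<in> schedules"
    unfolding \<sigma>_def by (intro copied_schedule adaptive_run[OF \<pi> order_refl])
  have "(1 - 1 / exp 1) * measure_pmf.expectation ?run (\<lambda>h. real (total_matches I J P1 h)) \<le>
    (1 - 1 / exp 1) * (\<Sum>j\<in>J. measure_pmf.expectation ?run (\<lambda>h. column_value j (arrival T h j)))"
    by (intro mult_left_mono adaptive_upper_bound[OF \<pi>]) simp
  also have "\<dots> \<le> (\<Sum>j\<in>J. measure_pmf.expectation Q (?col j))"
    unfolding sum_distrib_left by (intro sum_mono gap)
  also have "\<dots> = measure_pmf.expectation Q (\<lambda>H. \<Sum>j\<in>J. ?col j H)"
    using fin_Q by (intro Bochner_Integration.integral_sum[symmetric] integrable_measure_pmf_finite)
  also have "\<dots> \<le> (\<Sum>j\<in>J. ?col j H)" by (rule H(2))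
  also have "\<dots> = (\<Sum>j\<in>J. measure_pmf.expectation (run U \<phi> (greedy \<sigma>) T) (\<lambda>h. column_value j (arrival T h j)))"
  proof (intro sum.cong refl)
    fix j
    have "arrival_law T (\<phi> i j) j (\<lambda>s. \<sigma> (i, s)) T = law j i (H i)" if "i \<in> I" for i
      unfolding law_def using that by (intro arrival_law_cong) (simp add: \<sigma>_def)
    then have "Pi_pmf I T (\<lambda>i. arrival_law T (\<phi> i j) j (\<lambda>s. \<sigma> (i, s)) T) = Pi_pmf I T (\<lambda>i. law j i (H i))"
      by (intro Pi_pmf_cong refl)
    then show "?col j H = measure_pmf.expectation (run U \<phi> (greedy \<sigma>) T) (\<lambda>h. column_value j (arrival T h j))"
      unfolding expectation_greedy_column[OF \<sigma>] by simp
  qed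
  also have "\<dots> \<le> measure_pmf.expectation (run U \<phi> (greedy \<sigma>) T) (\<lambda>h. real (total_matches I J P1 h))"
    by (rule greedy_lower_bound[OF \<sigma>])
  finally show ?thesis using \<sigma> by blast
qed

end

theorem theorem5p4:
  fixes I J :: "'u set"
    and K :: "'u \<Rightarrow> nat"
    and P1 :: "'u \<Rightarrow> 'u set"
    and \<phi> :: "'u \<Rightarrow> 'u \<Rightarrow> real"
    and T :: nat
  assumes "finite I" and "finite J" and "I \<inter> J = {}"
    and "T \<ge> 1"
    and "\<And>l. l \<in> I \<union> J \<Longrightarrow> K l > 0"
    and "\<And>i. i \<in> I \<Longrightarrow> P1 i \<subseteq> J"
    and "\<And>j. j \<in> J \<Longrightarrow> P1 j \<subseteq> I"
    and "\<And>l l'. l \<in> I \<union> J \<Longrightarrow> l' \<in> I \<union> J \<Longrightarrow> l' \<in> P1 l \<longleftrightarrow> l \<in> P1 l'"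
    and "\<And>l l'. l \<in> I \<union> J \<Longrightarrow> l' \<in> I \<union> J \<Longrightarrow> 0 \<le> \<phi> l l' \<and> \<phi> l l' \<le> 1"
  shows "\<exists>p \<in> semi_adaptive_policies I J K P1 \<phi> T.
           expected_matches I J P1 \<phi> T p \<ge> (1 - 1 / exp 1) * OPT I J K P1 \<phi> T"
proof -
  interpret two_sided_market I J K P1 \<phi> T
    using assms by unfold_locales
  let ?E = "\<lambda>\<pi>. measure_pmf.expectation (run U \<phi> \<pi> T) (\<lambda>h. real (total_matches I J P1 h))"
  let ?c = "1 - 1 / exp 1 :: real"
  \<comment> \<open>The best schedule is chosen before any adaptive policy is considered. Its value
    bounds all of them uniformly, hence also the supremum, whether or not that is attained.\<close>
  let ?V = "(\<lambda>\<sigma>. ?E (greedy \<sigma>)) ` schedules"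
  have V: "finite ?V" "?V \<noteq> {}" using finite_schedules empty_schedule by auto
  obtain \<sigma> where \<sigma>: "\<sigma> \<in> schedules" "Max ?V = ?E (greedy \<sigma>)"
    using Max_in[OF V] by (rule imageE)
  have c: "0 < ?c" by simp
  have nonneg: "0 \<le> ?E (greedy \<sigma>) / ?c" using c by (intro divide_nonneg_pos integral_nonneg_AE) auto
  have bound: "?E \<pi> \<le> ?E (greedy \<sigma>) / ?c" if \<pi>: "adaptive_policy I J K P1 \<phi> T \<pi>" for \<pi>
  proof -
    from exists_good_schedule[OF \<pi>] obtain \<tau>
      where \<tau>: "\<tau> \<in> schedules" "?c * ?E \<pi> \<le> ?E (greedy \<tau>)" ..
    note \<tau>(2)
    also have "?E (greedy \<tau>) \<le> Max ?V" by (rule Max_ge[OF V(1) imageI[OF \<tau>(1)]])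
    also have "\<dots> = ?E (greedy \<sigma>)" by (rule \<sigma>(2))
    finally have "?c * ?E \<pi> \<le> ?E (greedy \<sigma>)" .
    then show ?thesis using c by (simp add: pos_le_divide_eq mult.commute)
  qed
  have "OPT I J K P1 \<phi> T \<le> ?E (greedy \<sigma>) / ?c"
    unfolding OPT_def
  proof (rule cSUP_least[OF adaptive_policies_nonempty])
    fix p assume p: "p \<in> adaptive_policies I J K P1 \<phi> T"
    then have \<pi>: "adaptive_policy I J K P1 \<phi> T \<pi>" if "\<pi> \<in> set_pmf p" for \<pi>
      using that by (simp add: adaptive_policies_def)
    show "expected_matches I J P1 \<phi> T p \<le> ?E (greedy \<sigma>) / ?c"
      unfolding expected_matches_def
      by (rule expectation_bind_le[OF _ nonneg integrable_measure_pmf_finite bound])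
        (simp_all add: \<pi> finite_set_run)
  qed
  then have "?c * OPT I J K P1 \<phi> T \<le> ?E (greedy \<sigma>)"
    using c by (simp add: pos_le_divide_eq mult.commute)
  also have "?E (greedy \<sigma>) = expected_matches I J P1 \<phi> T (return_pmf (greedy \<sigma>))"
    by (simp add: expected_matches_def bind_return_pmf)
  finally show ?thesis
    using greedy_semi_adaptive[OF \<sigma>(1)]
    by (intro bexI[of _ "return_pmf (greedy \<sigma>)"]) (simp_all add: semi_adaptive_policies_def)
qed

end
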